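(* Let $n,p,q\ge 1$ and let $x=(x_{ijk})\in\mathbb{C}^n\otimes\mathbb{C}^p\otimes\mathbb{C}^q$. Let $X_2=\mathrm{tr}_2(xx^* )\in M_n\otimes M_q$ and $X_3=\mathrm{tr}_3(xx^* )\in M_n\otimes M_p$. For $i=1,\dots,n$ let $$S_i=(x_{ijk})_{1\le j\le p,\,1\le k\le q}\in M_{p,q},\qquad R_i=S_i^t\in M_{q,p}.$$ Suppose $R_i$ has rank $k_i$, and write $R_i=U_iD_iV_i^t$, where $D_i\in M_{k_i}$ is a diagonal matrix with positive diagonal entries arranged in descending order and $U_i\in M_{q,k_i}$, $V_i\in M_{p,k_i}$ have orthonormal columns. Then the following conditions are equivalent. (a) There is a TPCP map $T:M_n\otimes M_q\to M_n\otimes M_p$ of the form $$T(X)=\sum_{j=1}^r(I_n\otimes F_j)X(I_n\otimes F_j)^*,\qquad F_1,\dots,F_r\in M_{p,q}$$ (for some $r$), satisfying $T(X_2)=X_3$. (b) There is a TPCP map $L:M_q\to M_p$ such that $L(R_uR_v^* )=S_uS_v^*$ for all $1\le u,v\le n$. (c) For some $r$ there are $p\times q$ matrices $F_1,\dots,F_r$ with $\sum_{j=1}^rF_j^*F_j=I_q$ and, for each $i=1,\dots,n$, $k_i\times p$ matrices $W_{i1},\dots,W_{ir}$ such that for all $i,j=1,\dots,n$, $$[F_1R_i\ \cdots\ F_rR_i]=V_iD_i[W_{i1}\ \cdots\ W_{ir}]\quad\text{and}\quad[W_{i1}\ \cdots\ W_{ir}][W_{j1}\ \cdots\ W_{jr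}]^*=U_i^t\,\overline{U_j}.$$
   Context: $M_{a,b}$ is the set of $a\times b$ complex matrices and $M_a=M_{a,a}$. $A^t$ is the transpose, $\overline{A}$ the entrywise conjugate, $A^*$ the conjugate transpose. The entries $x_{ijk}$ ($1\le i\le n$, $1\le j\le p$, $1\le k\le q$) of $x$ are arranged in lexicographic order of $(ijk)$. $\mathrm{tr}_1,\mathrm{tr}_2,\mathrm{tr}_3$ denote the partial traces over the first, second and third tensor factor of $\mathbb{C}^n\otimes\mathbb{C}^p\otimes\mathbb{C}^q$. Explicitly, $X_2=\sum_{j=1}^p y_jy_j^*$ with $y_j=(x_{ijk})_{i,k}\in\mathbb{C}^n\otimes\mathbb{C}^q$, and $X_3=\sum_{k=1}^q z_kz_k^*$ with $z_k=(x_{ijk})_{i,j}\in\mathbb{C}^n\otimes\mathbb{C}^p$. A TPCP map is a trace-preserving completely positive linear map; equivalently, a map $M_a\to M_b$ of the form $Y\mapsto\sum_{j=1}^r G_jYG_j^*$ with $G_j\in M_{b,a}$ and $\sum_jG_j^*G_j=I_a$. *)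

theory Defs
  imports "Jordan_Normal_Form.DL_Rank" "Jordan_Normal_Form.Schur_Decomposition"
begin

text \<open>All indices start at 0. A composite index is flattened lexicographically, so that the last
  factor varies fastest: the pair \<open>(u, v)\<close> with \<open>v < b\<close> is encoded as \<open>u * b + v\<close>, and is recovered
  from \<open>s = u * b + v\<close> by \<open>u = s div b\<close>, \<open>v = s mod b\<close>.\<close>


subsection \<open>Matrices\<close>

definition msum :: "nat \<Rightarrow> nat \<Rightarrow> nat \<Rightarrow> (nat \<Rightarrow> complex mat) \<Rightarrow> complex mat" where
  "msum nr nc r F = mat nr nc (\<lambda>(s, t). \<Sum>l<r. F l $$ (s, t))"

definition mat_conj :: "complex mat \<Rightarrow> complex mat" where
  "mat_conj A = map_mat cnj A"

text \<open>The rank one matrix \<open>x x\<^sup>*\<close>.\<close>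

definition outer :: "complex vec \<Rightarrow> complex mat" where
  "outer x = mat (dim_vec x) (dim_vec x) (\<lambda>(s, t). x $ s * cnj (x $ t))"

definition mat_trace :: "complex mat \<Rightarrow> complex" where
  "mat_trace A = (\<Sum>s<dim_row A. A $$ (s, s))"

definition kron :: "complex mat \<Rightarrow> complex mat \<Rightarrow> complex mat" where
  "kron A B = mat (dim_row A * dim_row B) (dim_col A * dim_col B)
     (\<lambda>(s, t). A $$ (s div dim_row B, t div dim_col B) * B $$ (s mod dim_row B, t mod dim_col B))"

text \<open>\<open>[A\<^sub>0 \<dots> A\<^sub>r\<^sub>-\<^sub>1]\<close> for blocks \<open>A\<^sub>l\<close> of size \<open>nr \<times> nc\<close>.\<close>

definition hcat :: "nat \<Rightarrow> nat \<Rightarrow> nat \<Rightarrow> (nat \<Rightarrow> complex mat) \<Rightarrow> complex mat" where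
  "hcat nr nc r A = mat nr (r * nc) (\<lambda>(s, t). A (t div nc) $$ (s, t mod nc))"

definition orthonormal_cols :: "complex mat \<Rightarrow> bool" where
  "orthonormal_cols A \<longleftrightarrow>
     (\<forall>s<dim_col A. \<forall>t<dim_col A. col A s \<bullet>c col A t = (if s = t then 1 else 0))"

text \<open>In the order on \<open>complex\<close>, \<open>0 \<le> z\<close> says that \<open>z\<close> is real and nonnegative; \<open>(A *\<^sub>v v) \<bullet>c v\<close> is
  \<open>v\<^sup>* A v\<close>. Over the complex numbers the condition forces \<open>A\<close> to be Hermitian.\<close>

definition psd :: "nat \<Rightarrow> complex mat \<Rightarrow> bool" where
  "psd d A \<longleftrightarrow> A \<in> carrier_mat d d \<and> (\<forall>v\<in>carrier_vec d. 0 \<le> (A *\<^sub>v v) \<bullet>c v)"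


subsection \<open>Trace-preserving completely positive maps\<close>

text \<open>A map \<open>M\<^sub>a \<rightarrow> M\<^sub>b\<close> is a function on \<open>complex mat\<close> whose values outside \<open>carrier_mat a a\<close> are
  irrelevant.\<close>

definition mat_linear :: "nat \<Rightarrow> nat \<Rightarrow> (complex mat \<Rightarrow> complex mat) \<Rightarrow> bool" where
  "mat_linear a b T \<longleftrightarrow>
     (\<forall>X\<in>carrier_mat a a. T X \<in> carrier_mat b b) \<and>
     (\<forall>X\<in>carrier_mat a a. \<forall>Y\<in>carrier_mat a a. T (X + Y) = T X + T Y) \<and>
     (\<forall>c. \<forall>X\<in>carrier_mat a a. T (c \<cdot>\<^sub>m X) = c \<cdot>\<^sub>m T X)"

text \<open>The \<open>(u, v)\<close> block of size \<open>a \<times> a\<close> of a block matrix.\<close>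

definition blk :: "nat \<Rightarrow> complex mat \<Rightarrow> nat \<Rightarrow> nat \<Rightarrow> complex mat" where
  "blk a X u v = mat a a (\<lambda>(s, t). X $$ (u * a + s, v * a + t))"

text \<open>\<open>id\<^sub>m \<otimes> T : M\<^sub>m \<otimes> M\<^sub>a \<rightarrow> M\<^sub>m \<otimes> M\<^sub>b\<close>, that is, \<open>T\<close> applied to each of the \<open>m \<times> m\<close> blocks.\<close>

definition ampliation ::
    "nat \<Rightarrow> nat \<Rightarrow> nat \<Rightarrow> (complex mat \<Rightarrow> complex mat) \<Rightarrow> complex mat \<Rightarrow> complex mat" where
  "ampliation m a b T X =
     mat (m * b) (m * b) (\<lambda>(s, t). T (blk a X (s div b) (t div b)) $$ (s mod b, t mod b))"

definition completely_positive :: "nat \<Rightarrow> nat \<Rightarrow> (complex mat \<Rightarrow> complex mat) \<Rightarrow> bool" where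
  "completely_positive a b T \<longleftrightarrow>
     (\<forall>m X. psd (m * a) X \<longrightarrow> psd (m * b) (ampliation m a b T X))"

definition trace_preserving :: "nat \<Rightarrow> (complex mat \<Rightarrow> complex mat) \<Rightarrow> bool" where
  "trace_preserving a T \<longleftrightarrow> (\<forall>X\<in>carrier_mat a a. mat_trace (T X) = mat_trace X)"

definition tpcp :: "nat \<Rightarrow> nat \<Rightarrow> (complex mat \<Rightarrow> complex mat) \<Rightarrow> bool" where
  "tpcp a b T \<longleftrightarrow> mat_linear a b T \<and> trace_preserving a T \<and> completely_positive a b T"


subsection \<open>Tripartite vectors\<close>

text \<open>Position of the entry \<open>x\<^sub>i\<^sub>j\<^sub>k\<close> in a vector \<open>x\<close> of length \<open>n * p * q\<close>.\<close>

definition idx3 :: "nat \<Rightarrow> nat \<Rightarrow> nat \<Rightarrow> nat \<Rightarrow> nat \<Rightarrow> nat" where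
  "idx3 p q i j k = (i * p + j) * q + k"

definition ptrace2 :: "nat \<Rightarrow> nat \<Rightarrow> nat \<Rightarrow> complex mat \<Rightarrow> complex mat" where
  "ptrace2 n p q X = mat (n * q) (n * q)
     (\<lambda>(s, t). \<Sum>j<p. X $$ (idx3 p q (s div q) j (s mod q), idx3 p q (t div q) j (t mod q)))"

definition ptrace3 :: "nat \<Rightarrow> nat \<Rightarrow> nat \<Rightarrow> complex mat \<Rightarrow> complex mat" where
  "ptrace3 n p q X = mat (n * p) (n * p)
     (\<lambda>(s, t). \<Sum>k<q. X $$ (idx3 p q (s div p) (s mod p) k, idx3 p q (t div p) (t mod p) k))"

definition slice_S :: "nat \<Rightarrow> nat \<Rightarrow> complex vec \<Rightarrow> nat \<Rightarrow> complex mat" where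
  "slice_S p q x i = mat p q (\<lambda>(j, k). x $ idx3 p q i j k)"

definition slice_R :: "nat \<Rightarrow> nat \<Rightarrow> complex vec \<Rightarrow> nat \<Rightarrow> complex mat" where
  "slice_R p q x i = transpose_mat (slice_S p q x i)"

lemma idx3_less:
  assumes "i < n" "j < p" "k < q"
  shows "idx3 p q i j k < n * p * q"
proof -
  have "Suc (i * p + j) \<le> Suc i * p" using assms by simp
  also have "\<dots> \<le> n * p" using assms by (intro mult_le_mono1) simp
  finally have "Suc (i * p + j) * q \<le> n * p * q" by (intro mult_le_mono1)
  then show ?thesis using assms by (simp add: idx3_def)
qed

lemma ptrace2_outer:
  assumes "x \<in> carrier_vec (n * p * q)"
  shows "ptrace2 n p q (outer x) = msum (n * q) (n * q) p
    (\<lambda>j. outer (vec (n * q) (\<lambda>s. x $ idx3 p q (s div q) j (s mod q))))"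
proof (rule eq_matI)
  fix s t
  assume "s < dim_row (msum (n * q) (n * q) p
      (\<lambda>j. outer (vec (n * q) (\<lambda>s. x $ idx3 p q (s div q) j (s mod q)))))"
    and "t < dim_col (msum (n * q) (n * q) p
      (\<lambda>j. outer (vec (n * q) (\<lambda>s. x $ idx3 p q (s div q) j (s mod q)))))"
  then have st: "s < n * q" "t < n * q" by (simp_all add: msum_def)
  then have q: "0 < q" by (cases q) auto
  have "s div q < n" "t div q < n" using st by (simp_all add: less_mult_imp_div_less)
  then show "ptrace2 n p q (outer x) $$ (s, t) = msum (n * q) (n * q) p
      (\<lambda>j. outer (vec (n * q) (\<lambda>s. x $ idx3 p q (s div q) j (s mod q)))) $$ (s, t)"
    using assms st q by (simp add: ptrace2_def msum_def outer_def idx3_less)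
qed (simp_all add: ptrace2_def msum_def)

lemma ptrace3_outer:
  assumes "x \<in> carrier_vec (n * p * q)"
  shows "ptrace3 n p q (outer x) = msum (n * p) (n * p) q
    (\<lambda>k. outer (vec (n * p) (\<lambda>s. x $ idx3 p q (s div p) (s mod p) k)))"
proof (rule eq_matI)
  fix s t
  assume "s < dim_row (msum (n * p) (n * p) q
      (\<lambda>k. outer (vec (n * p) (\<lambda>s. x $ idx3 p q (s div p) (s mod p) k))))"
    and "t < dim_col (msum (n * p) (n * p) q
      (\<lambda>k. outer (vec (n * p) (\<lambda>s. x $ idx3 p q (s div p) (s mod p) k))))"
  then have st: "s < n * p" "t < n * p" by (simp_all add: msum_def)
  then have p: "0 < p" by (cases p) auto
  have "s div p < n" "t div p < n" using st by (simp_all add: less_mult_imp_div_less)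
  then show "ptrace3 n p q (outer x) $$ (s, t) = msum (n * p) (n * p) q
      (\<lambda>k. outer (vec (n * p) (\<lambda>s. x $ idx3 p q (s div p) (s mod p) k))) $$ (s, t)"
    using assms st p by (simp add: ptrace3_def msum_def outer_def idx3_less)
qed (simp_all add: ptrace3_def msum_def)

end

theory Submission
  imports Defs
begin

text \<open>
  All three conditions are equivalent to the existence of Kraus operators \<open>F\<^sub>1, \<dots>, F\<^sub>r\<close> with
  \<open>\<Sum> F\<^sub>l\<^sup>* F\<^sub>l = 1\<close> and \<open>\<Sum> F\<^sub>l R\<^sub>u R\<^sub>v\<^sup>* F\<^sub>l\<^sup>* = S\<^sub>u S\<^sub>v\<^sup>*\<close> for all \<open>u, v\<close>.
  For (a), the \<open>(u, v)\<close> blocks of \<open>X\<^sub>2\<close> and \<open>X\<^sub>3\<close> are \<open>R\<^sub>u R\<^sub>v\<^sup>*\<close> and \<open>S\<^sub>u S\<^sub>v\<^sup>*\<close>, and \<open>T\<close> acts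
  blockwise. For (b), this is Choi's theorem.
  For (c), put \<open>H\<^sub>i = [F\<^sub>1 R\<^sub>i \<dots> F\<^sub>r R\<^sub>i]\<close>; the condition says \<open>H\<^sub>u H\<^sub>v\<^sup>* = S\<^sub>u S\<^sub>v\<^sup>*\<close>. As
  \<open>S\<^sub>i = V\<^sub>i D\<^sub>i U\<^sub>i\<^sup>t\<close>, the range of \<open>H\<^sub>i\<close> lies in that of \<open>V\<^sub>i\<close>, so that
  \<open>W\<^sub>i = D\<^sub>i\<^sup>-\<^sup>1 V\<^sub>i\<^sup>* H\<^sub>i\<close> satisfies \<open>H\<^sub>i = V\<^sub>i D\<^sub>i W\<^sub>i\<close>.
\<close>

subsection \<open>Adjoints\<close>

lemma mat_adjoint_dim [simp]:
  "dim_row (mat_adjoint A) = dim_col A" "dim_col (mat_adjoint A) = dim_row A"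
  by (simp_all add: mat_adjoint_def)

lemma mat_adjoint_index [simp]:
  fixes A :: "complex mat"
  assumes "s < dim_col A" "t < dim_row A"
  shows "mat_adjoint A $$ (s, t) = cnj (A $$ (t, s))"
  using assms by (simp add: mat_adjoint_def mat_of_rows_def)

lemma mat_adjoint_carrier [simp]: "A \<in> carrier_mat a b \<Longrightarrow> mat_adjoint A \<in> carrier_mat b a"
  by (metis carrier_matD carrier_matI mat_adjoint_dim)

text \<open>Matrix products as plain sums. \<open>index_mult_mat(1)\<close>, which yields scalar
  products of rows and columns, is deleted from the simpset where this form is wanted.\<close>

lemma mult_mat_index:
  assumes "s < dim_row A" "t < dim_col B" "dim_col A = dim_row B"
  shows "(A * B) $$ (s, t) = (\<Sum>c<dim_row B. A $$ (s, c) * B $$ (c, t))"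
  using assms by (auto simp: scalar_prod_def intro!: sum.cong)

lemma mat_adjoint_adjoint [simp]:
  fixes A :: "complex mat" shows "mat_adjoint (mat_adjoint A) = A"
  by (rule eq_matI) auto

lemma mat_adjoint_mult:
  fixes A B :: "complex mat"
  assumes "dim_col A = dim_row B"
  shows "mat_adjoint (A * B) = mat_adjoint B * mat_adjoint A"
  by (rule eq_matI)
    (use assms in \<open>simp_all add: mult_mat_index mult.commute del: index_mult_mat(1)\<close>)

lemma mat_adjoint_transpose: "mat_adjoint (transpose_mat A) = mat_conj A"
  by (rule eq_matI) (auto simp: mat_conj_def)

text \<open>Dimension equations in place of carrier sets make this a right-associating rewrite rule
  whose side conditions simp can discharge.\<close>

lemma mult_mat_assoc:
  fixes A B C :: "complex mat"
  assumes "dim_col A = dim_row B" "dim_col B = dim_row C"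
  shows "A * B * C = A * (B * C)"
  using assms by (intro assoc_mult_mat[of _ "dim_row A" "dim_col A" _ "dim_col B" _ "dim_col C"]) auto

text \<open>In a right-associated product \<open>A * B\<close> is no longer a subterm; this form
  still lets the pair cancel.\<close>

lemma mult_inverse_cancel:
  fixes A B X :: "complex mat"
  assumes "A * B = 1\<^sub>m d" "dim_col A = dim_row B" "dim_col B = d" "dim_row X = d"
  shows "A * (B * X) = X"
  using assms mult_mat_assoc[of A B X] by simp

text \<open>The diagonal entry \<open>(s, s)\<close> of \<open>A A^*\<close> is the sum of the
  squared moduli of row \<open>s\<close>.\<close>

lemma mult_adjoint_eq_0:
  fixes A :: "complex mat"
  assumes "A \<in> carrier_mat a b" "A * mat_adjoint A = 0\<^sub>m a a"
  shows "A = 0\<^sub>m a b"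
proof (rule eq_matI)
  fix s t assume "s < dim_row (0\<^sub>m a b :: complex mat)" "t < dim_col (0\<^sub>m a b :: complex mat)"
  then have st: "s < a" "t < b" by auto
  have "complex_of_real (\<Sum>c<b. (cmod (A $$ (s, c)))\<^sup>2) = (A * mat_adjoint A) $$ (s, s)"
    using assms(1) st by (simp add: mult_mat_index complex_norm_square del: index_mult_mat(1) of_real_power)
  also have "\<dots> = 0" using assms st by simp
  finally have "(\<Sum>c<b. (cmod (A $$ (s, c)))\<^sup>2) = 0" by (simp only: of_real_eq_0_iff)
  then show "A $$ (s, t) = 0\<^sub>m a b $$ (s, t)"
    using st by (simp add: sum_nonneg_eq_0_iff)
qed (use assms in auto)

lemma orthonormal_cols_adjoint_mult:
  assumes "V \<in> carrier_mat p k" "orthonormal_cols V"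
  shows "mat_adjoint V * V = 1\<^sub>m k"
proof (rule eq_matI)
  fix s t assume "s < dim_row (1\<^sub>m k :: complex mat)" "t < dim_col (1\<^sub>m k :: complex mat)"
  then have st: "s < k" "t < k" by auto
  then have "(mat_adjoint V * V) $$ (s, t) = col V t \<bullet>c col V s"
    using assms(1) by (auto simp: mult_mat_index scalar_prod_def mult.commute simp del: index_mult_mat(1) intro!: sum.cong)
  then show "(mat_adjoint V * V) $$ (s, t) = 1\<^sub>m k $$ (s, t)"
    using assms st by (simp add: orthonormal_cols_def del: index_mult_mat(1))
qed (use assms in auto)

text \<open>In the order on \<open>complex\<close>, \<open>0 < z\<close> forces \<open>z\<close> to
  be real.\<close>

lemma positive_diagonal_adjoint:
  fixes D :: "complex mat"
  assumes D: "D \<in> carrier_mat k k" "diagonal_mat D" "\<And>s. s < k \<Longrightarrow> 0 < D $$ (s, s)"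
  shows "mat_adjoint D = D"
proof (rule eq_matI)
  fix s t assume "s < dim_row D" "t < dim_col D"
  then have st: "s < k" "t < k" using D by auto
  show "mat_adjoint D $$ (s, t) = D $$ (s, t)"
  proof (cases "s = t")
    case True
    then show ?thesis using D(1) D(3)[OF st(1)] st by (simp add: less_complex_def complex_eq_iff)
  next
    case False
    then show ?thesis using D(1,2) st by (simp add: diagonal_mat_def)
  qed
qed (use D in auto)

text \<open>The diagonal entries are real and nonzero, so their reciprocals form a self-adjoint
  inverse.\<close>

lemma positive_diagonal_inverse:
  assumes D: "D \<in> carrier_mat k k" "diagonal_mat D" "\<And>s. s < k \<Longrightarrow> 0 < D $$ (s, s)"
  obtains E :: "complex mat" where "E \<in> carrier_mat k k" "E * D = 1\<^sub>m k" "D * E = 1\<^sub>m k" "mat_adjoint E = E"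
proof -
  define E where "E = mat k k (\<lambda>(s, t). if s = t then 1 / D $$ (s, s) else 0)"
  have off: "D $$ (s, t) = 0" if "s < k" "t < k" "s \<noteq> t" for s t
    using D that by (simp add: diagonal_mat_def)
  have nz: "D $$ (s, s) \<noteq> 0" and cn: "cnj (D $$ (s, s)) = D $$ (s, s)" if "s < k" for s
    using D(3)[OF that] by (auto simp: less_complex_def complex_eq_iff)
  have E: "E \<in> carrier_mat k k" by (simp add: E_def)
  moreover have "E * D = 1\<^sub>m k"
  proof (rule eq_matI)
    fix s t assume "s < dim_row (1\<^sub>m k :: complex mat)" "t < dim_col (1\<^sub>m k :: complex mat)"
    then have st: "s < k" "t < k" by auto
    have "(E * D) $$ (s, t) = (\<Sum>c<k. (if s = c then 1 / D $$ (s, s) else 0) * D $$ (c, t))"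
      using st D(1) by (simp add: mult_mat_index E_def del: index_mult_mat(1))
    also have "\<dots> = (\<Sum>c<k. if s = c then D $$ (s, t) / D $$ (s, s) else 0)"
      by (intro sum.cong) auto
    finally have "(E * D) $$ (s, t) = (if s = t then 1 else 0)"
      using st off nz by simp
    then show "(E * D) $$ (s, t) = 1\<^sub>m k $$ (s, t)" using st by simp
  qed (use D E in auto)
  moreover have "D * E = 1\<^sub>m k"
  proof (rule eq_matI)
    fix s t assume "s < dim_row (1\<^sub>m k :: complex mat)" "t < dim_col (1\<^sub>m k :: complex mat)"
    then have st: "s < k" "t < k" by auto
    have "(D * E) $$ (s, t) = (\<Sum>c<k. D $$ (s, c) * (if c = t then 1 / D $$ (c, c) else 0))"
      using st D(1) by (simp add: mult_mat_index E_def del: index_mult_mat(1))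
    also have "\<dots> = (\<Sum>c<k. if t = c then D $$ (s, t) / D $$ (t, t) else 0)"
      by (intro sum.cong) auto
    finally have "(D * E) $$ (s, t) = (if s = t then 1 else 0)"
      using st off nz by simp
    then show "(D * E) $$ (s, t) = 1\<^sub>m k $$ (s, t)" using st by simp
  qed (use D E in auto)
  moreover have "mat_adjoint E = E" by (rule eq_matI) (auto simp: E_def cn)
  ultimately show ?thesis by (rule that)
qed

lemma diagonal_mat_transpose:
  assumes "D \<in> carrier_mat k k" "diagonal_mat D"
  shows "transpose_mat D = D"
proof (rule eq_matI)
  fix s t assume "s < dim_row D" "t < dim_col D"
  then show "transpose_mat D $$ (s, t) = D $$ (s, t)"
    using assms by (cases "s = t") (auto simp: diagonal_mat_def)
qed (use assms in auto)

text \<open>If \<open>H H\<^sup>* = S S\<^sup>*\<close> then \<open>H\<close> and \<open>S\<close> have the same range, so a projection fixing \<open>S\<close> fixes \<open>H\<close>: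
  with \<open>Q = 1 - P\<close> one has \<open>(Q H) (Q H)\<^sup>* = (Q S) (Q S)\<^sup>* = 0\<close>.\<close>

lemma fixes_if_gram_eq:
  assumes P: "P \<in> carrier_mat p p" and S: "S \<in> carrier_mat p s" and H: "H \<in> carrier_mat p h"
    and gram: "H * mat_adjoint H = S * mat_adjoint S" and PS: "P * S = S"
  shows "P * H = (H :: complex mat)"
proof -
  define Q where "Q = 1\<^sub>m p - P"
  have Q: "Q \<in> carrier_mat p p" using P by (simp add: Q_def minus_carrier_mat)
  have dims: "dim_row Q = p" "dim_col Q = p" "dim_row S = p" "dim_col S = s"
    "dim_row H = p" "dim_col H = h" using Q S H by auto
  have QS: "Q * S = 0\<^sub>m p s"
    unfolding Q_def minus_mult_distrib_mat[OF one_carrier_mat P S] PS left_mult_one_mat[OF S]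
    using S by (rule minus_r_inv_mat)
  have "Q * H * mat_adjoint (Q * H) = Q * (H * mat_adjoint H) * mat_adjoint Q"
    by (simp add: mat_adjoint_mult mult_mat_assoc dims)
  also have "\<dots> = Q * S * mat_adjoint (Q * S)"
    unfolding gram by (simp add: mat_adjoint_mult mult_mat_assoc dims)
  also have "\<dots> = 0\<^sub>m p p"
    unfolding QS by (rule left_mult_zero_mat[of _ s p]) (rule mat_adjoint_carrier, rule zero_carrier_mat)
  finally have "Q * H = 0\<^sub>m p h"
    by (rule mult_adjoint_eq_0[OF mult_carrier_mat[OF Q H]])
  moreover have "Q * H = H - P * H"
    unfolding Q_def minus_mult_distrib_mat[OF one_carrier_mat P H] left_mult_one_mat[OF H] ..
  ultimately have "H - P * H = 0\<^sub>m p h" by metis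
  then have "(H - P * H) $$ (i, j) = 0" if "i < p" "j < h" for i j using that by simp
  then have eq: "(P * H) $$ (i, j) = H $$ (i, j)" if "i < p" "j < h" for i j
    using index_minus_mat(1)[of i "P * H" j H] P H that by (simp del: index_mult_mat(1))
  show ?thesis using P H by (intro eq_matI) (simp_all add: eq del: index_mult_mat(1))
qed

subsection \<open>Block matrices\<close>

lemma sum_lessThan_add:
  "(\<Sum>s<a + (b::nat). f s) = (\<Sum>s<a. f s) + (\<Sum>c<b. f (a + c) :: 'a::comm_monoid_add)"
  by (induction b) (simp_all add: add.assoc)

text \<open>Writing \<open>s = u * b + c\<close> with \<open>c < b\<close> matches the lexicographic
  flattening of composite indices, so sums in products of block matrices split into sums over
  blocks.\<close>

lemma sum_lessThan_mult:
  "(\<Sum>s<m * (b::nat). f s) = (\<Sum>u<m. \<Sum>c<b. f (u * b + c) :: 'a::comm_monoid_add)"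
proof (induction m)
  case (Suc m)
  have "(\<Sum>s<Suc m * b. f s) = (\<Sum>s<m * b + b. f s)" by (simp add: add.commute)
  also have "\<dots> = (\<Sum>s<m * b. f s) + (\<Sum>c<b. f (m * b + c))"
    by (rule sum_lessThan_add)
  finally show ?case by (simp add: Suc)
qed simp

lemma div_mult_less: "s < m * b \<Longrightarrow> s div b < m" for s m b :: nat
  by (simp add: less_mult_imp_div_less)

lemma mod_mult_less: "s < m * b \<Longrightarrow> s mod b < b" for s m b :: nat
  by (cases b) auto

lemma mult_add_less: "u < m \<Longrightarrow> c < b \<Longrightarrow> u * b + c < m * b" for u m b c :: nat
proof -
  assume "u < m" "c < b"
  then have "Suc u * b \<le> m * b" by (intro mult_le_mono1) simp
  with \<open>c < b\<close> show ?thesis by simp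
qed

section \<open>Kronecker products with an identity matrix\<close>

lemma kron_one_dim [simp]:
  "dim_row (kron (1\<^sub>m m) F) = m * dim_row F" "dim_col (kron (1\<^sub>m m) F) = m * dim_col F"
  by (simp_all add: kron_def)

lemma kron_one_index:
  assumes "u < m" "w < m" "i < dim_row F" "c < dim_col F"
  shows "kron (1\<^sub>m m) F $$ (u * dim_row F + i, w * dim_col F + c) = (if u = w then F $$ (i, c) else 0)"
  using assms by (simp add: kron_def mult_add_less)

text \<open>\<open>kron (1\<^sub>m m) F\<close> is block diagonal, so only the summand
  \<open>w = u\<close> survives in the sum over blocks.\<close>

lemma kron_one_mult_index:
  assumes "X \<in> carrier_mat (m * dim_col F) d" "u < m" "i < dim_row F" "t < d"
  shows "(kron (1\<^sub>m m) F * X) $$ (u * dim_row F + i, t) =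
    (\<Sum>c<dim_col F. F $$ (i, c) * X $$ (u * dim_col F + c, t))"
proof -
  have "(kron (1\<^sub>m m) F * X) $$ (u * dim_row F + i, t) =
      (\<Sum>w<m. \<Sum>c<dim_col F. (if u = w then F $$ (i, c) else 0) * X $$ (w * dim_col F + c, t))"
    using assms
    by (simp add: mult_mat_index mult_add_less sum_lessThan_mult kron_one_index del: index_mult_mat(1))
  also have "\<dots> = (\<Sum>w<m. if u = w then \<Sum>c<dim_col F. F $$ (i, c) * X $$ (w * dim_col F + c, t) else 0)"
    by (intro sum.cong) auto
  finally show ?thesis using assms by (simp add: sum.delta')
qed

lemma mult_kron_one_adjoint_index:
  assumes "Y \<in> carrier_mat d (m * dim_col F)" "v < m" "j < dim_row F" "s < d"
  shows "(Y * mat_adjoint (kron (1\<^sub>m m) F)) $$ (s, v * dim_row F + j) =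
    (\<Sum>c<dim_col F. Y $$ (s, v * dim_col F + c) * cnj (F $$ (j, c)))"
proof -
  have "(Y * mat_adjoint (kron (1\<^sub>m m) F)) $$ (s, v * dim_row F + j) =
      (\<Sum>w<m. \<Sum>c<dim_col F. Y $$ (s, w * dim_col F + c) * cnj (if v = w then F $$ (j, c) else 0))"
    using assms
    by (simp add: mult_mat_index mult_add_less sum_lessThan_mult kron_one_index del: index_mult_mat(1))
  also have "\<dots> = (\<Sum>w<m. if v = w then \<Sum>c<dim_col F. Y $$ (s, w * dim_col F + c) * cnj (F $$ (j, c)) else 0)"
    by (intro sum.cong) auto
  finally show ?thesis using assms by (simp add: sum.delta')
qed

lemma kron_one_carrier [simp]: "F \<in> carrier_mat b a \<Longrightarrow> kron (1\<^sub>m m) F \<in> carrier_mat (m * b) (m * a)"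
  by (metis carrier_matD carrier_matI kron_one_dim)

section \<open>Blocks of sums, ampliations and conjugations\<close>

lemma blk_carrier [simp]: "blk a X u v \<in> carrier_mat a a"
  and blk_dim [simp]: "dim_row (blk a X u v) = a" "dim_col (blk a X u v) = a"
  by (simp_all add: blk_def)

lemma blk_index [simp]:
  "s < a \<Longrightarrow> t < a \<Longrightarrow> blk a X u v $$ (s, t) = X $$ (u * a + s, v * a + t)"
  by (simp add: blk_def)

text \<open>Index \<open>s\<close> lies in block \<open>s div b\<close> at offset
  \<open>s mod b\<close>. Identities of large matrices are thus checked block by block.\<close>

lemma blk_eqI:
  assumes "A \<in> carrier_mat (m * b) (m * b)" "B \<in> carrier_mat (m * b) (m * b)"
    and "\<And>u v. u < m \<Longrightarrow> v < m \<Longrightarrow> blk b A u v = blk b B u v"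
  shows "A = B"
proof (rule eq_matI)
  fix s t assume "s < dim_row B" "t < dim_col B"
  then have st: "s < m * b" "t < m * b" using assms by auto
  then have "blk b A (s div b) (t div b) $$ (s mod b, t mod b) =
      blk b B (s div b) (t div b) $$ (s mod b, t mod b)"
    using assms(3) div_mult_less by metis
  then show "A $$ (s, t) = B $$ (s, t)"
    using st by (simp add: mod_mult_less)
qed (use assms in auto)

lemma msum_carrier [simp]: "msum a b r A \<in> carrier_mat a b"
  and msum_dim [simp]: "dim_row (msum a b r A) = a" "dim_col (msum a b r A) = b"
  by (simp_all add: msum_def)

lemma msum_index [simp]:
  "s < a \<Longrightarrow> t < b \<Longrightarrow> msum a b r A $$ (s, t) = (\<Sum>l<r. A l $$ (s, t))"
  by (simp add: msum_def)

lemma msum_cong: "(\<And>l. l < r \<Longrightarrow> A l = B l) \<Longrightarrow> msum a b r A = msum a b r B"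
  by (rule eq_matI) auto

lemma blk_msum:
  "u < m \<Longrightarrow> v < m \<Longrightarrow> blk b (msum (m * b) (m * b) r A) u v = msum b b r (\<lambda>l. blk b (A l) u v)"
  by (rule eq_matI) (auto simp: mult_add_less)

text \<open>The left side always has size \<open>b \<times> b\<close>; the carrier hypothesis gives
  the right side the same size.\<close>

lemma blk_ampliation:
  assumes "u < m" "v < m" "T (blk a X u v) \<in> carrier_mat b b"
  shows "blk b (ampliation m a b T X) u v = T (blk a X u v)"
  using assms by (intro eq_matI) (auto simp: mult_add_less ampliation_def)

text \<open>Both outer factors are block diagonal, so expanding the right and then the left one
  leaves only entries of block \<open>(u, v)\<close> of \<open>X\<close>.\<close>

lemma blk_kron_one_conjugation:
  assumes "X \<in> carrier_mat (m * a) (m * a)" "F \<in> carrier_mat b a" "u < m" "v < m"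
  shows "blk b (kron (1\<^sub>m m) F * X * mat_adjoint (kron (1\<^sub>m m) F)) u v
    = F * blk a X u v * mat_adjoint F"
proof (rule eq_matI)
  fix i j assume "i < dim_row (F * blk a X u v * mat_adjoint F)"
    "j < dim_col (F * blk a X u v * mat_adjoint F)"
  then have ij: "i < b" "j < b" using assms by auto
  have F: "dim_row F = b" "dim_col F = a" using assms by auto
  have KX: "kron (1\<^sub>m m) F * X \<in> carrier_mat (m * b) (m * dim_col F)"
    using assms F by (metis kron_one_carrier mult_carrier_mat)
  have "(kron (1\<^sub>m m) F * X * mat_adjoint (kron (1\<^sub>m m) F)) $$ (u * b + i, v * b + j) =
      (\<Sum>d<a. (kron (1\<^sub>m m) F * X) $$ (u * b + i, v * a + d) * cnj (F $$ (j, d)))"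
    using mult_kron_one_adjoint_index[OF KX, of v j "u * b + i"] assms ij F
    by (simp add: mult_add_less)
  also have "\<dots> = (\<Sum>d<a. (\<Sum>c<a. F $$ (i, c) * X $$ (u * a + c, v * a + d)) * cnj (F $$ (j, d)))"
  proof (rule sum.cong)
    fix d assume "d \<in> {..<a}"
    then show "(kron (1\<^sub>m m) F * X) $$ (u * b + i, v * a + d) * cnj (F $$ (j, d)) =
      (\<Sum>c<a. F $$ (i, c) * X $$ (u * a + c, v * a + d)) * cnj (F $$ (j, d))"
      using kron_one_mult_index[of X m F "m * a" u i "v * a + d"] assms ij F
      by (simp add: mult_add_less)
  qed simp
  also have "\<dots> = (F * blk a X u v * mat_adjoint F) $$ (i, j)"
    using assms ij F by (simp add: mult_mat_index del: index_mult_mat(1))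
  finally show "blk b (kron (1\<^sub>m m) F * X * mat_adjoint (kron (1\<^sub>m m) F)) u v $$ (i, j) =
    (F * blk a X u v * mat_adjoint F) $$ (i, j)" using ij by simp
qed (use assms in auto)

lemma mat_adjoint_kron_one: "mat_adjoint (kron (1\<^sub>m m) F) = kron (1\<^sub>m m) (mat_adjoint F)"
  by (rule eq_matI) (auto simp: kron_def div_mult_less mod_mult_less)

lemma blk_one:
  assumes "u < m" "v < m"
  shows "blk a (1\<^sub>m (m * a)) u v = (if u = v then 1\<^sub>m a else 0\<^sub>m a a)"
proof (rule eq_matI)
  fix s t assume "s < dim_row (if u = v then 1\<^sub>m a else 0\<^sub>m a a :: complex mat)"
    "t < dim_col (if u = v then 1\<^sub>m a else 0\<^sub>m a a :: complex mat)"
  then have st: "s < a" "t < a" by (auto split: if_splits)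
  have "u * a + s = v * a + t \<longleftrightarrow> u = v \<and> s = t"
  proof
    assume eq: "u * a + s = v * a + t"
    have "(u * a + s) div a = u" "(v * a + t) div a = v" using st by auto
    with eq show "u = v \<and> s = t" by auto
  qed simp
  then show "blk a (1\<^sub>m (m * a)) u v $$ (s, t) = (if u = v then 1\<^sub>m a else 0\<^sub>m a a) $$ (s, t)"
    using assms st by (simp add: mult_add_less)
qed auto

subsection \<open>Kraus maps\<close>

text \<open>The output size \<open>b\<close> is explicit, so that the empty sum \<open>r = 0\<close>
  is still a zero matrix of the right size.\<close>

definition kraus :: "nat \<Rightarrow> nat \<Rightarrow> (nat \<Rightarrow> complex mat) \<Rightarrow> complex mat \<Rightarrow> complex mat" where
  "kraus b r F X = msum b b r (\<lambda>l. F l * X * mat_adjoint (F l))"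

lemma kraus_carrier [simp]: "kraus b r F X \<in> carrier_mat b b"
  and kraus_dim [simp]: "dim_row (kraus b r F X) = b" "dim_col (kraus b r F X) = b"
  by (simp_all add: kraus_def)

text \<open>The coordinate form through which linearity, trace and positivity of Kraus maps are
  computed.\<close>

lemma kraus_index:
  assumes "\<And>l. l < r \<Longrightarrow> F l \<in> carrier_mat b a" "X \<in> carrier_mat a a" "i < b" "j < b"
  shows "kraus b r F X $$ (i, j) =
    (\<Sum>l<r. \<Sum>d<a. \<Sum>c<a. F l $$ (i, c) * X $$ (c, d) * cnj (F l $$ (j, d)))"
proof -
  have "(F l * X * mat_adjoint (F l)) $$ (i, j) =
      (\<Sum>d<a. \<Sum>c<a. F l $$ (i, c) * X $$ (c, d) * cnj (F l $$ (j, d)))" if "l < r" for l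
    using assms(1)[OF that] assms(2-)
    by (simp add: mult_mat_index sum_distrib_right del: index_mult_mat(1))
  then show ?thesis using assms by (simp add: kraus_def)
qed

lemma blk_kraus_kron_one:
  assumes "X \<in> carrier_mat (m * a) (m * a)" "\<And>l. l < r \<Longrightarrow> F l \<in> carrier_mat b a" "u < m" "v < m"
  shows "blk b (kraus (m * b) r (\<lambda>l. kron (1\<^sub>m m) (F l)) X) u v = kraus b r F (blk a X u v)"
  using assms by (auto simp: kraus_def blk_msum blk_kron_one_conjugation intro!: msum_cong)

text \<open>Both sides have the same blocks. An ampliation of a Kraus map is again a Kraus map, so
  its complete positivity reduces to positivity.\<close>

lemma ampliation_kraus:
  assumes "X \<in> carrier_mat (m * a) (m * a)" "\<And>l. l < r \<Longrightarrow> F l \<in> carrier_mat b a"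
  shows "ampliation m a b (kraus b r F) X = kraus (m * b) r (\<lambda>l. kron (1\<^sub>m m) (F l)) X"
proof (rule blk_eqI[of _ m b])
  fix u v assume "u < m" "v < m"
  then show "blk b (ampliation m a b (kraus b r F) X) u v =
      blk b (kraus (m * b) r (\<lambda>l. kron (1\<^sub>m m) (F l)) X) u v"
    using blk_ampliation[of u m v "kraus b r F" a X b] blk_kraus_kron_one[of X m a r F b u v] assms by simp
qed (simp_all add: ampliation_def)

lemma mat_linear_kraus:
  assumes "\<And>l. l < r \<Longrightarrow> F l \<in> carrier_mat b a"
  shows "mat_linear a b (kraus b r F)"
  unfolding mat_linear_def
proof (intro conjI ballI allI)
  fix X Y :: "complex mat" and c assume X: "X \<in> carrier_mat a a"
  show "kraus b r F (c \<cdot>\<^sub>m X) = c \<cdot>\<^sub>m kraus b r F X"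
    using assms X by (intro eq_matI) (simp_all add: kraus_index[of r F b a] sum_distrib_left mult_ac)
  assume Y: "Y \<in> carrier_mat a a"
  show "kraus b r F (X + Y) = kraus b r F X + kraus b r F Y"
    using assms X Y
    by (intro eq_matI) (simp_all add: kraus_index[of r F b a] distrib_left distrib_right sum.distrib)
qed simp

section \<open>Trace preservation of Kraus maps\<close>

definition unit_mat :: "nat \<Rightarrow> nat \<Rightarrow> nat \<Rightarrow> complex mat" where
  "unit_mat a u v = mat a a (\<lambda>(s, t). if s = u \<and> t = v then 1 else 0)"

lemma unit_mat_carrier [simp]: "unit_mat a u v \<in> carrier_mat a a"
  by (simp add: unit_mat_def)

text \<open>Cyclicity of the trace: the right side is the trace of \<open>G X\<close>, written out,
  for \<open>G\<close> the sum of all \<open>F_l^* F_l\<close>.\<close>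

lemma mat_trace_kraus:
  assumes F: "\<And>l. l < r \<Longrightarrow> F l \<in> carrier_mat b a" and X: "X \<in> carrier_mat a a"
  shows "mat_trace (kraus b r F X) =
    (\<Sum>d<a. \<Sum>c<a. msum a a r (\<lambda>l. mat_adjoint (F l) * F l) $$ (d, c) * X $$ (c, d))"
proof -
  have dim: "dim_row (F l) = b" "dim_col (F l) = a" if "l < r" for l
    using F[OF that] by auto
  have "mat_trace (kraus b r F X) =
      (\<Sum>i<b. \<Sum>l<r. \<Sum>d<a. \<Sum>c<a. F l $$ (i, c) * X $$ (c, d) * cnj (F l $$ (i, d)))"
    using F X by (auto simp: mat_trace_def kraus_index[of r F b a] intro!: sum.cong)
  also have "\<dots> = (\<Sum>l<r. \<Sum>d<a. \<Sum>c<a. \<Sum>i<b. F l $$ (i, c) * X $$ (c, d) * cnj (F l $$ (i, d)))"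
    by (simp only: sum.swap[where A = "{..<b}"])
  also have "\<dots> = (\<Sum>d<a. \<Sum>c<a. \<Sum>l<r. \<Sum>i<b. F l $$ (i, c) * X $$ (c, d) * cnj (F l $$ (i, d)))"
    by (simp only: sum.swap[where A = "{..<r}"])
  also have "\<dots> = (\<Sum>d<a. \<Sum>c<a. msum a a r (\<lambda>l. mat_adjoint (F l) * F l) $$ (d, c) * X $$ (c, d))"
  proof (intro sum.cong refl)
    fix d c assume "d \<in> {..<a}" "c \<in> {..<a}"
    then have "msum a a r (\<lambda>l. mat_adjoint (F l) * F l) $$ (d, c) =
        (\<Sum>l<r. \<Sum>i<b. cnj (F l $$ (i, d)) * F l $$ (i, c))"
      using F dim by (simp add: mult_mat_index del: index_mult_mat(1))
    then show "(\<Sum>l<r. \<Sum>i<b. F l $$ (i, c) * X $$ (c, d) * cnj (F l $$ (i, d))) =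
        msum a a r (\<lambda>l. mat_adjoint (F l) * F l) $$ (d, c) * X $$ (c, d)"
      by (simp add: sum_distrib_left mult_ac)
  qed
  finally show ?thesis .
qed

text \<open>A map and its Kraus form are only known to agree on
  \<open>carrier_mat a a\<close>.\<close>

lemma trace_preserving_cong:
  "(\<And>X. X \<in> carrier_mat a a \<Longrightarrow> T X = T' X) \<Longrightarrow> trace_preserving a T \<longleftrightarrow> trace_preserving a T'"
  by (simp add: trace_preserving_def)

text \<open>Testing trace preservation on the matrix unit at \<open>(t, s)\<close> reads off the
  entry \<open>(s, t)\<close> of the sum of all \<open>F_l^* F_l\<close>. The converse is cyclicity
  of the trace.\<close>

lemma trace_preserving_kraus_iff:
  assumes F: "\<And>l. l < r \<Longrightarrow> F l \<in> carrier_mat b a"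
  shows "trace_preserving a (kraus b r F) \<longleftrightarrow> msum a a r (\<lambda>l. mat_adjoint (F l) * F l) = 1\<^sub>m a"
    (is "_ \<longleftrightarrow> ?G = _")
proof
  assume tp: "trace_preserving a (kraus b r F)"
  show "?G = 1\<^sub>m a"
  proof (rule eq_matI)
    fix s t assume "s < dim_row (1\<^sub>m a :: complex mat)" "t < dim_col (1\<^sub>m a :: complex mat)"
    then have st: "s < a" "t < a" by auto
    have "(\<Sum>d<a. \<Sum>c<a. ?G $$ (d, c) * unit_mat a t s $$ (c, d)) = mat_trace (unit_mat a t s)"
      using tp F mat_trace_kraus[of r F b a "unit_mat a t s"] by (simp add: trace_preserving_def)
    moreover have "(\<Sum>d<a. \<Sum>c<a. ?G $$ (d, c) * unit_mat a t s $$ (c, d)) =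
        (\<Sum>d<a. \<Sum>c<a. if c = t then if d = s then ?G $$ (s, t) else 0 else 0)"
      by (intro sum.cong) (auto simp: unit_mat_def)
    moreover have "mat_trace (unit_mat a t s) = (\<Sum>c<a. if c = t then if t = s then 1 else 0 else 0)"
      by (auto simp: mat_trace_def unit_mat_def intro!: sum.cong)
    ultimately show "?G $$ (s, t) = 1\<^sub>m a $$ (s, t)"
      using st by (simp add: sum.delta del: msum_index)
  qed auto
next
  assume "?G = 1\<^sub>m a"
  then have "mat_trace (kraus b r F X) = mat_trace X" if "X \<in> carrier_mat a a" for X
  proof -
    have "mat_trace (kraus b r F X) = (\<Sum>d<a. \<Sum>c<a. if c = d then X $$ (c, d) else 0)"
      using mat_trace_kraus[of r F b a X] F that \<open>?G = 1\<^sub>m a\<close>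
      by (simp only:) (intro sum.cong refl, auto)
    with that show ?thesis by (simp add: mat_trace_def)
  qed
  then show "trace_preserving a (kraus b r F)" by (simp add: trace_preserving_def)
qed

text \<open>The large sum is block diagonal with the small sum in every diagonal block. As
  \<open>0 < m\<close>, the block \<open>(0, 0)\<close> exists and recovers the small sum.\<close>

lemma kron_one_kraus_complete_iff:
  assumes F: "\<And>l. l < r \<Longrightarrow> F l \<in> carrier_mat b a" and m: "0 < m"
  shows "msum (m * a) (m * a) r (\<lambda>l. mat_adjoint (kron (1\<^sub>m m) (F l)) * kron (1\<^sub>m m) (F l)) = 1\<^sub>m (m * a)
    \<longleftrightarrow> msum a a r (\<lambda>l. mat_adjoint (F l) * F l) = 1\<^sub>m a" (is "?L = _ \<longleftrightarrow> ?G = _")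
proof -
  have one: "blk a (mat_adjoint (kron (1\<^sub>m m) (F l)) * kron (1\<^sub>m m) (F l)) u v =
      (if u = v then mat_adjoint (F l) * F l else 0\<^sub>m a a)" if "l < r" "u < m" "v < m" for l u v
  proof -
    let ?K = "kron (1\<^sub>m m) (F l)"
    have Fl: "mat_adjoint (F l) \<in> carrier_mat a b" and dims: "dim_row (F l) = b" "dim_col (F l) = a"
      using F[OF that(1)] by auto
    have "mat_adjoint ?K \<in> carrier_mat (m * a) (m * b)" using F[OF that(1)] by simp
    \<comment> \<open>Inserting an identity turns \<open>K^* K\<close> into a conjugation by
      \<open>K^*\<close>, whose blocks are known.\<close>
    then have "blk a (mat_adjoint ?K * ?K) u v =
        blk a (mat_adjoint ?K * 1\<^sub>m (m * b) * mat_adjoint (mat_adjoint ?K)) u v"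
      by (simp only: mat_adjoint_adjoint right_mult_one_mat)
    also have "\<dots> = mat_adjoint (F l) * blk b (1\<^sub>m (m * b)) u v * mat_adjoint (mat_adjoint (F l))"
      unfolding mat_adjoint_kron_one[of m "F l"] using Fl that(2,3) by (intro blk_kron_one_conjugation) simp_all
    also have "\<dots> = (if u = v then mat_adjoint (F l) * F l else 0\<^sub>m a a)"
    proof (cases "u = v")
      case True
      then show ?thesis
        unfolding blk_one[OF that(2,3)] mat_adjoint_adjoint by (simp only: simp_thms if_True right_mult_one_mat[OF Fl])
    next
      case False
      then show ?thesis unfolding blk_one[OF that(2,3)] mat_adjoint_adjoint
        by (simp only: if_False right_mult_zero_mat[OF Fl] left_mult_zero_mat[OF F[OF that(1)]])
    qed
    finally show ?thesis .
  qed
  have L: "blk a ?L u v = (if u = v then ?G else 0\<^sub>m a a)" if "u < m" "v < m" for u v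
  proof -
    have "blk a ?L u v = msum a a r (\<lambda>l. if u = v then mat_adjoint (F l) * F l else 0\<^sub>m a a)"
      unfolding blk_msum[OF that] by (intro msum_cong) (simp only: one[OF _ that])
    moreover have "msum a a r (\<lambda>l. 0\<^sub>m a a) = 0\<^sub>m a a" by (rule eq_matI) simp_all
    ultimately show ?thesis by (cases "u = v") (simp_all only: if_True if_False simp_thms)
  qed
  show ?thesis
  proof
    assume L1: "?L = 1\<^sub>m (m * a)"
    have "?G = blk a ?L 0 0" unfolding L[OF m m] by (simp only: if_True simp_thms)
    also have "\<dots> = 1\<^sub>m a" unfolding L1 blk_one[OF m m] by (simp only: if_True simp_thms)
    finally show "?G = 1\<^sub>m a" .
  next
    assume G: "?G = 1\<^sub>m a"
    show "?L = 1\<^sub>m (m * a)"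
    proof (rule blk_eqI[OF msum_carrier one_carrier_mat])
      fix u v assume "u < m" "v < m"
      then show "blk a ?L u v = blk a (1\<^sub>m (m * a)) u v" by (simp only: L blk_one G)
    qed
  qed
qed

subsection \<open>Positive semidefinite matrices\<close>

text \<open>Functions instead of matrices and vectors: the size \<open>d\<close> can change in an
  induction without any carrier conditions.\<close>

definition posform :: "nat \<Rightarrow> (nat \<Rightarrow> nat \<Rightarrow> complex) \<Rightarrow> bool" where
  "posform d A \<longleftrightarrow> (\<forall>f. 0 \<le> (\<Sum>s<d. \<Sum>t<d. A s t * f t * cnj (f s)))"

lemma psd_iff_posform:
  assumes "A \<in> carrier_mat d d"
  shows "psd d A \<longleftrightarrow> posform d (\<lambda>s t. A $$ (s, t))"
proof -
  have eq: "(A *\<^sub>v vec d f) \<bullet>c vec d f = (\<Sum>s<d. \<Sum>t<d. A $$ (s, t) * f t * cnj (f s))" for f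
    using assms by (auto simp: scalar_prod_def sum_distrib_right intro!: sum.cong)
  have "vec d (\<lambda>i. v $ i) = v" if "v \<in> carrier_vec d" for v :: "complex vec"
    using that by auto
  then have "(\<forall>v\<in>carrier_vec d. 0 \<le> (A *\<^sub>v v) \<bullet>c v) \<longleftrightarrow> (\<forall>f. 0 \<le> (A *\<^sub>v vec d f) \<bullet>c vec d f)"
    by (metis vec_carrier)
  then show ?thesis unfolding eq using assms by (simp add: psd_def posform_def)
qed

text \<open>Test functions supported on one or two points isolate the entries of
  \<open>A\<close>.\<close>

lemma form_support:
  fixes A :: "nat \<Rightarrow> nat \<Rightarrow> complex"
  assumes "S \<subseteq> {..<d}" "\<And>s. s \<notin> S \<Longrightarrow> f s = 0"
  shows "(\<Sum>s<d. \<Sum>t<d. A s t * f t * cnj (f s)) = (\<Sum>s\<in>S. \<Sum>t\<in>S. A s t * f t * cnj (f s))"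
proof -
  have "(\<Sum>t<d. A s t * f t * cnj (f s)) = (\<Sum>t\<in>S. A s t * f t * cnj (f s))" for s
    using assms by (intro sum.mono_neutral_right) auto
  then have "(\<Sum>s<d. \<Sum>t<d. A s t * f t * cnj (f s)) = (\<Sum>s<d. \<Sum>t\<in>S. A s t * f t * cnj (f s))"
    by simp
  also have "\<dots> = (\<Sum>s\<in>S. \<Sum>t\<in>S. A s t * f t * cnj (f s))"
    using assms by (intro sum.mono_neutral_right) auto
  finally show ?thesis .
qed

lemma posform_diag:
  assumes "posform d A" "s < d"
  shows "0 \<le> A s s"
proof -
  have "0 \<le> (\<Sum>i<d. \<Sum>j<d. A i j * (if j = s then 1 else 0) * cnj (if i = s then 1 else 0))"
    using assms(1) by (auto simp: posform_def)
  also have "\<dots> = A s s"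
    by (subst form_support[of "{s}"]) (use assms in auto)
  finally show ?thesis .
qed

lemma posform_two:
  assumes "posform d A" "s < d" "t < d" "s \<noteq> t"
  shows "0 \<le> A s s * x * cnj x + A s t * y * cnj x + A t s * x * cnj y + A t t * y * cnj y"
proof -
  define f where "f i = (if i = s then x else if i = t then y else 0)" for i
  have "0 \<le> (\<Sum>i<d. \<Sum>j<d. A i j * f j * cnj (f i))"
    using assms(1) by (auto simp: posform_def)
  also have "\<dots> = A s s * x * cnj x + A s t * y * cnj x + A t s * x * cnj y + A t t * y * cnj y"
    by (subst form_support[of "{s, t}"]) (use assms in \<open>auto simp: f_def\<close>)
  finally show ?thesis .
qed

text \<open>Polarisation: the form is real at \<open>(1, 1)\<close> and at \<open>(1, \<i>)\<close>,
  which compares the imaginary and the real parts of \<open>A s t\<close> and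
  \<open>A t s\<close>.\<close>

lemma posform_hermitian:
  assumes "posform d A" "s < d" "t < d"
  shows "A s t = cnj (A t s)"
proof (cases "s = t")
  case True
  then show ?thesis using posform_diag[OF assms(1,2)] by (simp add: complex_eq_iff less_eq_complex_def)
next
  case False
  have "Im (A s s) = 0" "Im (A t t) = 0"
    using posform_diag[OF assms(1)] assms by (simp_all add: less_eq_complex_def)
  then show ?thesis
    using posform_two[OF assms False, of 1 1] posform_two[OF assms False, of 1 \<i>]
    by (simp add: complex_eq_iff less_eq_complex_def)
qed

text \<open>If \<open>A t t = 0\<close>, the form at \<open>(1, y)\<close> has no quadratic term in
  \<open>y\<close>, so a nonzero \<open>A s t\<close> would make it unbounded below.\<close>

lemma posform_zero_diag:
  assumes "posform d A" "s < d" "t < d" "A t t = 0"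
  shows "A s t = 0"
proof (rule ccontr)
  assume nz: "A s t \<noteq> 0"
  then have "s \<noteq> t" using assms by auto
  \<comment> \<open>Chosen so that both cross terms equal \<open>- \<rho>\<close>; the form then has
    the value \<open>A s s - 2 * (A s s + 1) < 0\<close>.\<close>
  define \<rho> where "\<rho> = complex_of_real (Re (A s s) + 1)"
  define y where "y = - \<rho> / A s t"
  have "A t s = cnj (A s t)" using posform_hermitian assms by blast
  then have "A s t * y = - \<rho>" "A t s * cnj y = - \<rho>"
    using nz by (simp_all add: y_def \<rho>_def)
  then have "0 \<le> A s s - \<rho> - \<rho>"
    using posform_two[OF assms(1-3) \<open>s \<noteq> t\<close>, of 1 y] assms(4) by simp
  moreover have "0 \<le> Re (A s s)" using posform_diag[OF assms(1,2)] by (simp add: less_eq_complex_def)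
  ultimately show False by (simp add: \<rho>_def less_eq_complex_def)
qed

text \<open>One step of Cholesky elimination: completing the square in the last variable leaves the
  Schur complement. If the pivot vanishes then so does its row, and division by 0 yields 0, as
  it should.\<close>

lemma posform_schur_complement:
  assumes "posform (Suc d) A"
  shows "posform d (\<lambda>s t. A s t - A s d * A d t / A d d)"
  unfolding posform_def
proof
  fix f :: "nat \<Rightarrow> complex"
  define z where "z = (\<Sum>t<d. A d t * f t)"
  \<comment> \<open>For a positive pivot this last coordinate minimises the form; for a zero pivot
    it is 0.\<close>
  define g where "g = f(d := - z / A d d)"
  have g: "g t = f t" if "t < d" for t using that by (simp add: g_def)
  have "A s d * cnj (f s) = cnj (A d s * f s)" if "s < d" for s
    using posform_hermitian[OF assms, of s d] that by simp
  then have cz: "(\<Sum>s<d. A s d * cnj (f s)) = cnj z" by (simp only: z_def cnj_sum) (auto intro!: sum.cong)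
  have al: "cnj (A d d) = A d d" by (metis posform_hermitian[OF assms lessI lessI])
  have "0 \<le> (\<Sum>s<Suc d. \<Sum>t<Suc d. A s t * g t * cnj (g s))"
    using assms unfolding posform_def by blast
  also have "(\<Sum>s<Suc d. \<Sum>t<Suc d. A s t * g t * cnj (g s)) =
      (\<Sum>s<d. \<Sum>t<d. A s t * f t * cnj (f s)) + (\<Sum>s<d. A s d * cnj (f s)) * g d
      + (\<Sum>t<d. A d t * f t) * cnj (g d) + A d d * g d * cnj (g d)"
    by (simp add: g sum.distrib sum_distrib_left sum_distrib_right mult_ac)
  also have "\<dots> = (\<Sum>s<d. \<Sum>t<d. A s t * f t * cnj (f s)) - z * cnj z / A d d"
    unfolding cz z_def[symmetric] by (cases "A d d = 0") (simp_all add: g_def al divide_simps)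
  also have "z * cnj z / A d d = (\<Sum>s<d. \<Sum>t<d. A s d * A d t / A d d * f t * cnj (f s))"
    unfolding cz[symmetric] by (simp add: z_def sum_distrib_left sum_distrib_right sum_divide_distrib mult_ac)
  also have "(\<Sum>s<d. \<Sum>t<d. A s t * f t * cnj (f s)) - \<dots> =
      (\<Sum>s<d. \<Sum>t<d. (A s t - A s d * A d t / A d d) * f t * cnj (f s))"
    by (simp add: sum_subtractf left_diff_distrib)
  finally show "0 \<le> (\<Sum>s<d. \<Sum>t<d. (A s t - A s d * A d t / A d d) * f t * cnj (f s))" .
qed

text \<open>Cholesky decomposition by induction on \<open>d\<close>: the Schur complement is
  decomposed by the induction hypothesis, and the last column divided by the square root of the
  pivot gives one more rank one term.\<close>

lemma posform_sum_rank_one: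
  assumes "posform d A"
  shows "\<exists>g. \<forall>s<d. \<forall>t<d. A s t = (\<Sum>l<d. g l s * cnj (g l t))"
  using assms
proof (induction d arbitrary: A)
  case (Suc d)
  obtain g where g: "\<And>s t. s < d \<Longrightarrow> t < d \<Longrightarrow>
      A s t - A s d * A d t / A d d = (\<Sum>l<d. g l s * cnj (g l t))"
    using Suc.IH[OF posform_schur_complement[OF Suc.prems]] by blast
  define r where "r = complex_of_real (sqrt (Re (A d d)))"
  have "0 \<le> A d d" using posform_diag[OF Suc.prems] by simp
  then have re: "of_real (Re (A d d)) = A d d" "0 \<le> Re (A d d)"
    by (simp_all add: less_eq_complex_def complex_eq_iff)
  have "r * r = of_real (Re (A d d))" using re(2) unfolding r_def by (simp flip: of_real_mult)
  then have r: "r * r = A d d" "cnj r = r" unfolding re(1) by (simp_all add: r_def)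
  \<comment> \<open>The earlier vectors are extended by 0 at \<open>d\<close>. The new one is the
    last column over \<open>r\<close>, hence zero if the pivot is 0.\<close>
  define h where "h l s = (if l = d then A s d / r else if s < d then g l s else 0)" for l s
  have rank1: "A s d / r * cnj (A t d / r) = A s d * A d t / A d d" if "t < Suc d" for s t
    unfolding posform_hermitian[OF Suc.prems lessI that] using r by simp
  \<comment> \<open>In the last row and column the new rank one term alone has to reproduce
    \<open>A\<close>; for a zero pivot both sides vanish.\<close>
  have last: "A s d * A d t / A d d = A s t" if "s = d \<or> t = d" "s < Suc d" "t < Suc d" for s t
  proof (cases "A d d = 0")
    case True
    then have z: "A i d = 0" if "i < Suc d" for i
      using posform_zero_diag[OF Suc.prems that, of d] by simp
    have "A d t = cnj (A t d)"
      using posform_hermitian[OF Suc.prems, of d t] that(3) by simp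
    then show ?thesis using z that True by auto
  qed (use that in auto)
  have "A s t = (\<Sum>l<Suc d. h l s * cnj (h l t))" if st: "s < Suc d" "t < Suc d" for s t
  proof -
    have "(\<Sum>l<Suc d. h l s * cnj (h l t)) =
        (\<Sum>l<d. h l s * cnj (h l t)) + A s d * A d t / A d d"
      using rank1[OF st(2), of s] by (simp add: h_def)
    moreover have "(\<Sum>l<d. h l s * cnj (h l t)) =
        (if s < d \<and> t < d then A s t - A s d * A d t / A d d else 0)"
      by (simp add: g h_def)
    ultimately show ?thesis using last[OF _ st] st by (auto simp: less_Suc_eq)
  qed
  then show ?case by blast
qed simp

subsection \<open>Kraus operators of completely positive maps\<close>

text \<open>The form of the image at \<open>f\<close> is the sum over \<open>l\<close> of the form
  of \<open>X\<close> at \<open>F_l^* f\<close>, which is \<open>w l\<close> below.\<close>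

lemma psd_kraus:
  assumes F: "\<And>l. l < r \<Longrightarrow> F l \<in> carrier_mat b a" and X: "psd a X"
  shows "psd b (kraus b r F X)"
proof -
  have Xc: "X \<in> carrier_mat a a" using X by (simp add: psd_def)
  have "0 \<le> (\<Sum>s<b. \<Sum>t<b. kraus b r F X $$ (s, t) * f t * cnj (f s))" for f
  proof -
    define w where "w l d = (\<Sum>t<b. cnj (F l $$ (t, d)) * f t)" for l d
    have "(\<Sum>s<b. \<Sum>t<b. kraus b r F X $$ (s, t) * f t * cnj (f s)) =
        (\<Sum>s<b. \<Sum>t<b. \<Sum>l<r. \<Sum>d<a. \<Sum>c<a.
          X $$ (c, d) * ((F l $$ (s, c) * cnj (f s)) * (cnj (F l $$ (t, d)) * f t)))"
      using F Xc by (simp add: kraus_index[of r F b a] sum_distrib_left sum_distrib_right mult_ac)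
    also have "\<dots> = (\<Sum>l<r. \<Sum>d<a. \<Sum>c<a. \<Sum>s<b. \<Sum>t<b.
          X $$ (c, d) * ((F l $$ (s, c) * cnj (f s)) * (cnj (F l $$ (t, d)) * f t)))"
      by (simp only: sum.swap[where A = "{..<b}" and B = "{..<r}"] sum.swap[where A = "{..<b}" and B = "{..<a}"])
    also have "\<dots> = (\<Sum>l<r. \<Sum>d<a. \<Sum>c<a. X $$ (c, d) * w l d * cnj (w l c))"
    proof (intro sum.cong refl)
      fix l d c
      have w: "cnj (w l c) = (\<Sum>s<b. F l $$ (s, c) * cnj (f s))" by (simp add: w_def)
      have "X $$ (c, d) * w l d * cnj (w l c) = X $$ (c, d) * (cnj (w l c) * w l d)" by simp
      also have "\<dots> = (\<Sum>s<b. \<Sum>t<b. X $$ (c, d) *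
          ((F l $$ (s, c) * cnj (f s)) * (cnj (F l $$ (t, d)) * f t)))"
        unfolding w by (simp only: w_def sum_product) (simp only: sum_distrib_left)
      finally show "(\<Sum>s<b. \<Sum>t<b. X $$ (c, d) * ((F l $$ (s, c) * cnj (f s)) * (cnj (F l $$ (t, d)) * f t)))
          = X $$ (c, d) * w l d * cnj (w l c)" ..
    qed
    also have "\<dots> = (\<Sum>l<r. \<Sum>c<a. \<Sum>d<a. X $$ (c, d) * w l d * cnj (w l c))"
      by (intro sum.cong refl sum.swap)
    also have "0 \<le> \<dots>"
      using X unfolding psd_iff_posform[OF Xc] posform_def by (intro sum_nonneg[of "{..<r}"]) blast
    finally show ?thesis .
  qed
  then show ?thesis by (simp add: psd_iff_posform posform_def)
qed

lemma tpcp_kraus: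
  assumes F: "\<And>l. l < r \<Longrightarrow> F l \<in> carrier_mat b a"
    and "msum a a r (\<lambda>l. mat_adjoint (F l) * F l) = 1\<^sub>m a"
  shows "tpcp a b (kraus b r F)"
  unfolding tpcp_def
proof (intro conjI)
  show "mat_linear a b (kraus b r F)" using F by (rule mat_linear_kraus)
  show "trace_preserving a (kraus b r F)" using trace_preserving_kraus_iff[of r F b a] assms by simp
  show "completely_positive a b (kraus b r F)"
    unfolding completely_positive_def
  proof (intro allI impI)
    fix m X assume X: "psd (m * a) X"
    then have "ampliation m a b (kraus b r F) X = kraus (m * b) r (\<lambda>l. kron (1\<^sub>m m) (F l)) X"
      using ampliation_kraus[of X m a r F b] F by (simp add: psd_def)
    then show "psd (m * b) (ampliation m a b (kraus b r F) X)"
      using psd_kraus[of r "\<lambda>l. kron (1\<^sub>m m) (F l)" "m * b" "m * a" X] F X by simp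
  qed
qed

text \<open>Induction over a set of index pairs outside which \<open>X\<close> vanishes, splitting
  off one matrix unit at a time.\<close>

lemma mat_linear_eqI:
  assumes T: "mat_linear a b T" and T': "mat_linear a b T'"
    and unit: "\<And>u v. u < a \<Longrightarrow> v < a \<Longrightarrow> T (unit_mat a u v) = T' (unit_mat a u v)"
    and X: "X \<in> carrier_mat a a"
  shows "T X = T' X"
proof -
  have "\<forall>X\<in>carrier_mat a a. (\<forall>s<a. \<forall>t<a. (s, t) \<notin> S \<longrightarrow> X $$ (s, t) = 0) \<longrightarrow> T X = T' X"
    if "finite S" "S \<subseteq> {..<a} \<times> {..<a}" for S
    using that
  proof (induction S)
    case empty
    have "T X = T' X" if X: "X \<in> carrier_mat a a" "\<forall>s<a. \<forall>t<a. X $$ (s, t) = 0" for X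
    proof -
      \<comment> \<open>That a linear map sends 0 to 0 comes from homogeneity with the scalar
        0.\<close>
      have "0 \<cdot>\<^sub>m X = X" using X by (intro eq_matI) auto
      moreover have "T (0 \<cdot>\<^sub>m X) = 0 \<cdot>\<^sub>m T X" "T' (0 \<cdot>\<^sub>m X) = 0 \<cdot>\<^sub>m T' X"
        "T X \<in> carrier_mat b b" "T' X \<in> carrier_mat b b"
        using T T' X by (auto simp: mat_linear_def)
      moreover have "0 \<cdot>\<^sub>m M = 0\<^sub>m b b" if "M \<in> carrier_mat b b" for M :: "complex mat"
        using that by (intro eq_matI) auto
      ultimately show ?thesis by (metis (full_types))
    qed
    then show ?case by auto
  next
    case (insert e S)
    obtain u v where e: "e = (u, v)" "u < a" "v < a" using insert.prems by auto
    show ?case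
    proof (intro ballI impI)
      fix X :: "complex mat"
      assume X: "X \<in> carrier_mat a a" "\<forall>s<a. \<forall>t<a. (s, t) \<notin> insert e S \<longrightarrow> X $$ (s, t) = 0"
      define Y where "Y = mat a a (\<lambda>(s, t). if (s, t) = e then 0 else X $$ (s, t))"
      have Y: "Y \<in> carrier_mat a a" by (simp add: Y_def)
      have split: "X = Y + X $$ (u, v) \<cdot>\<^sub>m unit_mat a u v"
        using X(1) e by (intro eq_matI) (auto simp: Y_def unit_mat_def)
      have "\<forall>s<a. \<forall>t<a. (s, t) \<notin> S \<longrightarrow> Y $$ (s, t) = 0"
        using X(2) by (simp add: Y_def)
      then have "T Y = T' Y" using insert.IH insert.prems Y by blast
      moreover have lin: "G (Y + c \<cdot>\<^sub>m unit_mat a u v) = G Y + c \<cdot>\<^sub>m G (unit_mat a u v)"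
        if "mat_linear a b G" for G and c :: complex
        using that Y by (simp add: mat_linear_def)
      ultimately show "T X = T' X"
        using unit e by (subst (1 2) split) (simp add: lin[OF T] lin[OF T'])
    qed
  qed
  from this[of "{..<a} \<times> {..<a}"] X show ?thesis by simp
qed

text \<open>Choi's theorem. The Kraus operators are read off a rank one decomposition of the Choi matrix
  \<open>(L(E\<^sub>u\<^sub>v))\<^sub>u\<^sub>v\<close>, the image under the ampliation of \<open>e e\<^sup>*\<close> for the maximally entangled vector \<open>e\<close>.\<close>

lemma choi:
  assumes L: "mat_linear a b L" and cp: "completely_positive a b L"
  obtains r F where "\<And>l. l < r \<Longrightarrow> F l \<in> carrier_mat b a"
    and "\<And>X. X \<in> carrier_mat a a \<Longrightarrow> L X = kraus b r F X"
proof -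
  define E where "E = mat (a * a) (a * a) (\<lambda>(s, t).
    (if s div a = s mod a then 1 else 0) * (if t div a = t mod a then 1 else 0 :: complex))"
  \<comment> \<open>As \<open>E = e e^*\<close>, its form at \<open>f\<close> is the squared modulus
    of the inner product of \<open>f\<close> and \<open>e\<close>.\<close>
  have form: "(\<Sum>s<a * a. \<Sum>t<a * a. E $$ (s, t) * f t * cnj (f s)) =
      (\<Sum>t<a * a. (if t div a = t mod a then f t else 0)) *
      cnj (\<Sum>t<a * a. (if t div a = t mod a then f t else 0))" for f
    by (subst mult.commute, simp only: cnj_sum sum_product)
      (auto simp: E_def intro!: sum.cong)
  have "E \<in> carrier_mat (a * a) (a * a)" by (simp add: E_def)
  moreover have "0 \<le> z * cnj z" for z by (simp add: less_eq_complex_def)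
  ultimately have "psd (a * a) E" by (simp only: psd_iff_posform posform_def form) blast
  then have psd: "psd (a * b) (ampliation a a b L E)"
    using cp by (auto simp: completely_positive_def)
  have blk: "blk a E u v = unit_mat a u v" if "u < a" "v < a" for u v
    using that by (intro eq_matI) (auto simp: E_def unit_mat_def mult_add_less)
  have Lc: "L (unit_mat a u v) \<in> carrier_mat b b" for u v
    using L by (simp add: mat_linear_def)
  have "ampliation a a b L E \<in> carrier_mat (a * b) (a * b)" by (simp add: ampliation_def)
  then have "posform (a * b) (\<lambda>s t. ampliation a a b L E $$ (s, t))"
    using psd psd_iff_posform by blast
  from posform_sum_rank_one[OF this] obtain g where g: "\<And>s t. s < a * b \<Longrightarrow> t < a * b \<Longrightarrow>
      ampliation a a b L E $$ (s, t) = (\<Sum>l<a * b. g l s * cnj (g l t))"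
    by blast
  \<comment> \<open>Each vector \<open>g l\<close> of length \<open>a * b\<close> is cut into
    \<open>a\<close> pieces of length \<open>b\<close>, the columns of \<open>F l\<close>.\<close>
  define F where "F l = mat b a (\<lambda>(i, u). g l (u * b + i))" for l :: nat
  have Fc: "F l \<in> carrier_mat b a" for l by (simp add: F_def)
  have "L (unit_mat a u v) = kraus b (a * b) F (unit_mat a u v)" if uv: "u < a" "v < a" for u v
  proof (rule eq_matI)
    fix i j assume "i < dim_row (kraus b (a * b) F (unit_mat a u v))"
      "j < dim_col (kraus b (a * b) F (unit_mat a u v))"
    then have ij: "i < b" "j < b" by auto
    have "L (unit_mat a u v) $$ (i, j) = blk b (ampliation a a b L E) u v $$ (i, j)"
      using blk_ampliation[of u a v L a E b] blk[OF uv] Lc uv by simp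
    also have "\<dots> = (\<Sum>l<a * b. F l $$ (i, u) * cnj (F l $$ (j, v)))"
      using ij uv by (simp add: g mult_add_less F_def)
    also have "\<dots> = (\<Sum>l<a * b. \<Sum>d<a. \<Sum>c<a. if c = u then if d = v then F l $$ (i, u) * cnj (F l $$ (j, v)) else 0 else 0)"
      using uv by (simp add: sum.delta)
    also have "\<dots> = kraus b (a * b) F (unit_mat a u v) $$ (i, j)"
      using Fc ij
      by (subst kraus_index[where a = a]) (simp_all only: unit_mat_carrier, intro sum.cong refl, simp add: unit_mat_def)
    finally show "L (unit_mat a u v) $$ (i, j) = kraus b (a * b) F (unit_mat a u v) $$ (i, j)" .
  qed (use Lc[of u v] in auto)
  then have "L X = kraus b (a * b) F X" if "X \<in> carrier_mat a a" for X
    using mat_linear_eqI[OF L mat_linear_kraus[of "a * b" F b a] _ that] Fc by simp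
  with Fc show ?thesis by (rule that)
qed

subsection \<open>Slices and concatenation\<close>

lemma slice_carrier [simp]: "slice_S p q x i \<in> carrier_mat p q" "slice_R p q x i \<in> carrier_mat q p"
  by (simp_all add: slice_S_def slice_R_def)

lemma slice_dim [simp]:
  "dim_row (slice_S p q x i) = p" "dim_col (slice_S p q x i) = q"
  "dim_row (slice_R p q x i) = q" "dim_col (slice_R p q x i) = p"
  by (simp_all add: slice_S_def slice_R_def)

text \<open>Rows of \<open>R_u\<close> carry the third tensor index and columns the second, so the
  product sums over exactly the index that is traced out.\<close>

lemma blk_ptrace2:
  assumes "x \<in> carrier_vec (n * p * q)" "u < n" "v < n"
  shows "blk q (ptrace2 n p q (outer x)) u v = slice_R p q x u * mat_adjoint (slice_R p q x v)"
  using assms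
  by (intro eq_matI)
    (auto simp: ptrace2_def outer_def idx3_less mult_add_less mult_mat_index slice_R_def slice_S_def
      simp del: index_mult_mat(1))

lemma blk_ptrace3:
  assumes "x \<in> carrier_vec (n * p * q)" "u < n" "v < n"
  shows "blk p (ptrace3 n p q (outer x)) u v = slice_S p q x u * mat_adjoint (slice_S p q x v)"
  using assms
  by (intro eq_matI)
    (auto simp: ptrace3_def outer_def idx3_less mult_add_less mult_mat_index slice_S_def
      simp del: index_mult_mat(1))

section \<open>Concatenated blocks and their Gram products\<close>

lemma hcat_carrier [simp]: "hcat a b r A \<in> carrier_mat a (r * b)"
  and hcat_dim [simp]: "dim_row (hcat a b r A) = a" "dim_col (hcat a b r A) = r * b"
  by (simp_all add: hcat_def)

lemma hcat_mult_adjoint: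
  assumes "\<And>l. l < r \<Longrightarrow> A l \<in> carrier_mat a c" "\<And>l. l < r \<Longrightarrow> B l \<in> carrier_mat b c"
  shows "hcat a c r A * mat_adjoint (hcat b c r B) = msum a b r (\<lambda>l. A l * mat_adjoint (B l))"
proof (rule eq_matI)
  fix s t assume "s < dim_row (msum a b r (\<lambda>l. A l * mat_adjoint (B l)))"
    "t < dim_col (msum a b r (\<lambda>l. A l * mat_adjoint (B l)))"
  then have st: "s < a" "t < b" by auto
  have "(hcat a c r A * mat_adjoint (hcat b c r B)) $$ (s, t) =
      (\<Sum>l<r. \<Sum>d<c. A l $$ (s, d) * cnj (B l $$ (t, d)))"
    using st by (simp add: mult_mat_index sum_lessThan_mult hcat_def mult_add_less del: index_mult_mat(1))
  also have "\<dots> = (\<Sum>l<r. (A l * mat_adjoint (B l)) $$ (s, t))"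
  proof (intro sum.cong refl)
    fix l assume "l \<in> {..<r}"
    then have "A l \<in> carrier_mat a c" "B l \<in> carrier_mat b c" using assms by auto
    then show "(\<Sum>d<c. A l $$ (s, d) * cnj (B l $$ (t, d))) = (A l * mat_adjoint (B l)) $$ (s, t)"
      using st by (simp add: mult_mat_index del: index_mult_mat(1))
  qed
  finally show "(hcat a c r A * mat_adjoint (hcat b c r B)) $$ (s, t) =
      msum a b r (\<lambda>l. A l * mat_adjoint (B l)) $$ (s, t)" using st by simp
qed auto

lemma mult_hcat:
  assumes "M \<in> carrier_mat b a" "\<And>l. l < r \<Longrightarrow> A l \<in> carrier_mat a c"
  shows "M * hcat a c r A = hcat b c r (\<lambda>l. M * A l)"
proof (rule eq_matI)
  fix s t assume "s < dim_row (hcat b c r (\<lambda>l. M * A l))" "t < dim_col (hcat b c r (\<lambda>l. M * A l))"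
  then have st: "s < b" "t < r * c" by auto
  then have "A (t div c) \<in> carrier_mat a c" using assms div_mult_less by blast
  then show "(M * hcat a c r A) $$ (s, t) = hcat b c r (\<lambda>l. M * A l) $$ (s, t)"
    using assms(1) st mod_mult_less[OF st(2)]
    by (simp add: mult_mat_index hcat_def del: index_mult_mat(1))
qed (use assms in auto)

text \<open>Links (c) with the Kraus equations: values of the Kraus map at \<open>R R'^*\<close> are
  Gram products of block rows.\<close>

lemma hcat_gram_kraus:
  assumes F: "\<And>l. l < r \<Longrightarrow> F l \<in> carrier_mat p q" and R: "R \<in> carrier_mat q p" "R' \<in> carrier_mat q p"
  shows "hcat p p r (\<lambda>l. F l * R) * mat_adjoint (hcat p p r (\<lambda>l. F l * R')) =
    kraus p r F (R * mat_adjoint R')"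
proof -
  have "hcat p p r (\<lambda>l. F l * R) * mat_adjoint (hcat p p r (\<lambda>l. F l * R')) =
      msum p p r (\<lambda>l. F l * R * mat_adjoint (F l * R'))"
    using F R by (intro hcat_mult_adjoint) (metis mult_carrier_mat)+
  also have "\<dots> = kraus p r F (R * mat_adjoint R')"
    unfolding kraus_def
  proof (rule msum_cong)
    fix l assume "l < r"
    then have "dim_row (F l) = p" "dim_col (F l) = q" using F by auto
    then show "F l * R * mat_adjoint (F l * R') = F l * (R * mat_adjoint R') * mat_adjoint (F l)"
      using R by (simp add: mat_adjoint_mult mult_mat_assoc)
  qed
  finally show ?thesis .
qed

theorem theorem3p1:
  fixes n p q :: nat and x :: "complex vec"
    and k :: "nat \<Rightarrow> nat" and U D V :: "nat \<Rightarrow> complex mat"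
  assumes "1 \<le> n" and "1 \<le> p" and "1 \<le> q"
    and "x \<in> carrier_vec (n * p * q)"
    and "\<And>i. i < n \<Longrightarrow> vec_space.rank q (slice_R p q x i) = k i"
    and "\<And>i. i < n \<Longrightarrow> U i \<in> carrier_mat q (k i) \<and> orthonormal_cols (U i)"
    and "\<And>i. i < n \<Longrightarrow> V i \<in> carrier_mat p (k i) \<and> orthonormal_cols (V i)"
    and "\<And>i. i < n \<Longrightarrow> D i \<in> carrier_mat (k i) (k i) \<and> diagonal_mat (D i)"
    and "\<And>i s. i < n \<Longrightarrow> s < k i \<Longrightarrow> 0 < D i $$ (s, s)"
    and "\<And>i s t. i < n \<Longrightarrow> s \<le> t \<Longrightarrow> t < k i \<Longrightarrow> D i $$ (t, t) \<le> D i $$ (s, s)"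
    and "\<And>i. i < n \<Longrightarrow> slice_R p q x i = U i * D i * transpose_mat (V i)"
  defines "condition_a \<equiv>
      (\<exists>T. tpcp (n * q) (n * p) T \<and>
        (\<exists>r F. (\<forall>j<r. F j \<in> carrier_mat p q) \<and>
          (\<forall>X\<in>carrier_mat (n * q) (n * q).
            T X = msum (n * p) (n * p) r
                    (\<lambda>j. kron (1\<^sub>m n) (F j) * X * mat_adjoint (kron (1\<^sub>m n) (F j))))) \<and>
        T (ptrace2 n p q (outer x)) = ptrace3 n p q (outer x))"
    and "condition_b \<equiv>
      (\<exists>L. tpcp q p L \<and>
        (\<forall>u<n. \<forall>v<n. L (slice_R p q x u * mat_adjoint (slice_R p q x v))
                       = slice_S p q x u * mat_adjoint (slice_S p q x v)))"
    and "condition_c \<equiv>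
      (\<exists>r F W. (\<forall>l<r. F l \<in> carrier_mat p q) \<and>
        msum q q r (\<lambda>l. mat_adjoint (F l) * F l) = 1\<^sub>m q \<and>
        (\<forall>i<n. \<forall>l<r. W i l \<in> carrier_mat (k i) p) \<and>
        (\<forall>i<n. \<forall>j<n.
          hcat p p r (\<lambda>l. F l * slice_R p q x i) = V i * D i * hcat (k i) p r (W i) \<and>
          hcat (k i) p r (W i) * mat_adjoint (hcat (k j) p r (W j))
            = transpose_mat (U i) * mat_conj (U j)))"
  shows "(condition_a \<longleftrightarrow> condition_b) \<and> (condition_b \<longleftrightarrow> condition_c)"
proof -
  define R where "R = slice_R p q x"
  define S where "S = slice_S p q x"
  have Rc [simp]: "R i \<in> carrier_mat q p" and Sc [simp]: "S i \<in> carrier_mat p q" for i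
    by (simp_all add: R_def S_def)
  have RR [simp]: "R u * mat_adjoint (R v) \<in> carrier_mat q q" for u v
    by (rule mult_carrier_mat[OF Rc mat_adjoint_carrier[OF Rc]])
  define kraus_form where "kraus_form \<longleftrightarrow> (\<exists>r F. (\<forall>l<r. F l \<in> carrier_mat p q) \<and>
      msum q q r (\<lambda>l. mat_adjoint (F l) * F l) = 1\<^sub>m q \<and>
      (\<forall>u<n. \<forall>v<n. kraus p r F (R u * mat_adjoint (R v)) = S u * mat_adjoint (S v)))"
  have n: "0 < n" using assms(1) by simp
  have X2: "ptrace2 n p q (outer x) \<in> carrier_mat (n * q) (n * q)"
    and X3: "ptrace3 n p q (outer x) \<in> carrier_mat (n * p) (n * p)"
    by (simp_all add: ptrace2_def ptrace3_def)
  have blk_kraus: "blk p (kraus (n * p) r (\<lambda>j. kron (1\<^sub>m n) (F j)) (ptrace2 n p q (outer x))) u v =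
      kraus p r F (R u * mat_adjoint (R v))"
    if "\<forall>l<r. F l \<in> carrier_mat p q" "u < n" "v < n" for r F u v
    using blk_kraus_kron_one[OF X2, of r F p u v] that blk_ptrace2[OF assms(4) that(2,3)]
    by (simp add: R_def)
  have blk_X3: "blk p (ptrace3 n p q (outer x)) u v = S u * mat_adjoint (S v)" if "u < n" "v < n" for u v
    using blk_ptrace3[OF assms(4) that] by (simp add: S_def)

  \<comment> \<open>Condition (a) and the Kraus equations\<close>
  have "condition_a \<longleftrightarrow> kraus_form"
  proof
    assume condition_a
    then obtain T r F where T: "tpcp (n * q) (n * p) T" and F: "\<forall>j<r. F j \<in> carrier_mat p q"
      and TX: "\<And>X. X \<in> carrier_mat (n * q) (n * q) \<Longrightarrow> T X = kraus (n * p) r (\<lambda>j. kron (1\<^sub>m n) (F j)) X"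
      and T23: "T (ptrace2 n p q (outer x)) = ptrace3 n p q (outer x)"
      unfolding condition_a_def kraus_def by blast
    have "trace_preserving (n * q) (kraus (n * p) r (\<lambda>j. kron (1\<^sub>m n) (F j)))"
      using T by (simp only: tpcp_def trace_preserving_cong[OF TX])
    \<comment> \<open>Trace preservation is completeness of the operators
      \<open>1 \<otimes> F_l\<close>; since \<open>0 < n\<close> it descends to the
      \<open>F_l\<close>.\<close>
    then have "msum q q r (\<lambda>l. mat_adjoint (F l) * F l) = 1\<^sub>m q"
      using trace_preserving_kraus_iff[of r "\<lambda>j. kron (1\<^sub>m n) (F j)" "n * p" "n * q"]
        kron_one_kraus_complete_iff[of r F p q n] F n kron_one_carrier by metis
    moreover have "kraus p r F (R u * mat_adjoint (R v)) = S u * mat_adjoint (S v)"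
      if "u < n" "v < n" for u v
      using blk_kraus[OF F that] blk_X3[OF that] T23 TX[OF X2] by metis
    ultimately show kraus_form unfolding kraus_form_def using F by blast
  next
    assume kraus_form
    then obtain r F where F: "\<forall>l<r. F l \<in> carrier_mat p q"
      and one: "msum q q r (\<lambda>l. mat_adjoint (F l) * F l) = 1\<^sub>m q"
      and FR: "\<And>u v. u < n \<Longrightarrow> v < n \<Longrightarrow> kraus p r F (R u * mat_adjoint (R v)) = S u * mat_adjoint (S v)"
      unfolding kraus_form_def by blast
    let ?T = "kraus (n * p) r (\<lambda>j. kron (1\<^sub>m n) (F j))"
    have tp: "tpcp (n * q) (n * p) ?T"
      using F one n kron_one_kraus_complete_iff[of r F p q n] by (intro tpcp_kraus) simp_all
    have T23: "?T (ptrace2 n p q (outer x)) = ptrace3 n p q (outer x)"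
      by (rule blk_eqI[OF kraus_carrier X3]) (simp only: blk_kraus[OF F] blk_X3 FR)
    show condition_a
      unfolding condition_a_def kraus_def[symmetric]
      by (intro exI[of _ ?T] exI[of _ r] exI[of _ F] conjI ballI refl tp F T23)
  qed

  \<comment> \<open>Condition (b) and the Kraus equations\<close>
  moreover have "condition_b \<longleftrightarrow> kraus_form"
  proof
    assume condition_b
    then obtain L where L: "tpcp q p L"
      and LR: "\<And>u v. u < n \<Longrightarrow> v < n \<Longrightarrow> L (R u * mat_adjoint (R v)) = S u * mat_adjoint (S v)"
      unfolding condition_b_def R_def S_def by blast
    obtain r F where F: "\<And>l. l < r \<Longrightarrow> F l \<in> carrier_mat p q"
      and LX: "\<And>X. X \<in> carrier_mat q q \<Longrightarrow> L X = kraus p r F X"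
      using choi[of q p L] L unfolding tpcp_def by blast
    have "trace_preserving q (kraus p r F)"
      using L trace_preserving_cong[OF LX] by (simp only: tpcp_def)
    then have "msum q q r (\<lambda>l. mat_adjoint (F l) * F l) = 1\<^sub>m q"
      using trace_preserving_kraus_iff F by blast
    moreover have "kraus p r F (R u * mat_adjoint (R v)) = S u * mat_adjoint (S v)"
      if "u < n" "v < n" for u v
      using LR[OF that] LX[OF RR] by metis
    ultimately show kraus_form unfolding kraus_form_def using F by blast
  next
    assume kraus_form
    then show condition_b
      unfolding kraus_form_def condition_b_def R_def S_def using tpcp_kraus by blast
  qed

  \<comment> \<open>Condition (c) and the Kraus equations\<close>
  moreover have "condition_c \<longleftrightarrow> kraus_form"
  proof -
    have "\<exists>E. E \<in> carrier_mat (k i) (k i) \<and> E * D i = 1\<^sub>m (k i) \<and> D i * E = 1\<^sub>m (k i) \<and> mat_adjoint E = E"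
      if "i < n" for i
      using positive_diagonal_inverse[of "D i" "k i"] assms(8,9) that by metis
    then obtain E where E: "\<And>i. i < n \<Longrightarrow> E i \<in> carrier_mat (k i) (k i)"
        "\<And>i. i < n \<Longrightarrow> E i * D i = 1\<^sub>m (k i)" "\<And>i. i < n \<Longrightarrow> D i * E i = 1\<^sub>m (k i)"
        "\<And>i. i < n \<Longrightarrow> mat_adjoint (E i) = E i"
      by metis
    have dims: "dim_row (U i) = q" "dim_col (U i) = k i" "dim_row (V i) = p" "dim_col (V i) = k i"
      "dim_row (D i) = k i" "dim_col (D i) = k i" "dim_row (E i) = k i" "dim_col (E i) = k i" if "i < n" for i
      using assms(6-8)[OF that] E(1)[OF that] by auto
    have dims': "dim_row (R i) = q" "dim_col (R i) = p" "dim_row (S i) = p" "dim_col (S i) = q" for i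
      by (simp_all add: R_def S_def)
    have dimc: "dim_row (mat_conj A) = dim_row A" "dim_col (mat_conj A) = dim_col A" for A
      by (simp_all add: mat_conj_def)
    have VV: "mat_adjoint (V i) * V i = 1\<^sub>m (k i)" if "i < n" for i
      using assms(7)[OF that] orthonormal_cols_adjoint_mult by blast
    have Dt: "transpose_mat (D i) = D i" if "i < n" for i
      using assms(8)[OF that] diagonal_mat_transpose by blast
    have Dadj: "mat_adjoint (D i) = D i" if "i < n" for i
      using positive_diagonal_adjoint[of "D i" "k i"] assms(8,9) that by blast
    \<comment> \<open>The transpose of the given factorisation of \<open>R_i\<close>, with
      \<open>D_i\<close> symmetric.\<close>
    have S: "S i = V i * (D i * transpose_mat (U i))" if "i < n" for i
    proof -
      have "S i = transpose_mat (R i)" by (simp add: S_def R_def slice_R_def)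
      also have "\<dots> = transpose_mat (transpose_mat (V i)) * transpose_mat (U i * D i)"
        unfolding R_def assms(11)[OF that] using dims[OF that]
        by (intro transpose_mult[of _ q "k i" _ p]) (auto intro!: carrier_matI)
      also have "transpose_mat (U i * D i) = transpose_mat (D i) * transpose_mat (U i)"
        using dims[OF that] by (intro transpose_mult[of _ q "k i" _ "k i"]) (auto intro!: carrier_matI)
      finally show ?thesis using Dt[OF that] by simp
    qed
    have Sadj: "mat_adjoint (S i) = mat_conj (U i) * (D i * mat_adjoint (V i))" if "i < n" for i
      using that by (simp add: S mat_adjoint_mult mult_mat_assoc dims dimc Dadj mat_adjoint_transpose)
    note assoc = mat_adjoint_mult mult_mat_assoc dims dims' dimc
    \<comment> \<open>Once \<open>assoc\<close> has moved adjoints inwards and brackets to the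
      right, these rules remove \<open>V^* V\<close>, \<open>E D\<close> and \<open>D E\<close> in
      front of a further factor.\<close>
    note cancel = mult_inverse_cancel[OF VV] mult_inverse_cancel[OF E(2)] mult_inverse_cancel[OF E(3)]
    show ?thesis
    proof
      assume condition_c
      then obtain r F W where F: "\<And>l. l < r \<Longrightarrow> F l \<in> carrier_mat p q"
        and one: "msum q q r (\<lambda>l. mat_adjoint (F l) * F l) = 1\<^sub>m q"
        and H: "\<And>i. i < n \<Longrightarrow> hcat p p r (\<lambda>l. F l * R i) = V i * D i * hcat (k i) p r (W i)"
        and W: "\<And>i j. i < n \<Longrightarrow> j < n \<Longrightarrow> hcat (k i) p r (W i) * mat_adjoint (hcat (k j) p r (W j))
            = transpose_mat (U i) * mat_conj (U j)"
        unfolding condition_c_def R_def by blast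
      have "kraus p r F (R u * mat_adjoint (R v)) = S u * mat_adjoint (S v)" if "u < n" "v < n" for u v
      proof -
        \<comment> \<open>The Gram product of the two block rows, with \<open>V D W\<close> inserted
          for each; \<open>D v\<close> is self-adjoint.\<close>
        have "kraus p r F (R u * mat_adjoint (R v)) =
            V u * D u * (hcat (k u) p r (W u) * mat_adjoint (hcat (k v) p r (W v))) * (D v * mat_adjoint (V v))"
          using hcat_gram_kraus[of r F p q "R u" "R v"] F that by (simp add: H assoc Dadj)
        also have "\<dots> = S u * mat_adjoint (S v)"
          unfolding W[OF that] S[OF that(1)] Sadj[OF that(2)] using that by (simp add: assoc)
        finally show ?thesis .
      qed
      then show kraus_form unfolding kraus_form_def using F one by blast
    next
      assume kraus_form
      then obtain r F where F: "\<And>l. l < r \<Longrightarrow> F l \<in> carrier_mat p q"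
        and one: "msum q q r (\<lambda>l. mat_adjoint (F l) * F l) = 1\<^sub>m q"
        and FR: "\<And>u v. u < n \<Longrightarrow> v < n \<Longrightarrow> kraus p r F (R u * mat_adjoint (R v)) = S u * mat_adjoint (S v)"
        unfolding kraus_form_def by blast
      define H where "H i = hcat p p r (\<lambda>l. F l * R i)" for i
      have Hdim: "dim_row (H i) = p" "dim_col (H i) = r * p" for i by (simp_all add: H_def)
      have gram: "H i * mat_adjoint (H j) = S i * mat_adjoint (S j)" if "i < n" "j < n" for i j
        using hcat_gram_kraus[of r F p q "R i" "R j"] F FR[OF that] by (simp add: H_def)
      \<comment> \<open>Solves \<open>V_i D_i W_il = F_l R_i\<close> block by block:
        \<open>V_i^*\<close> is a left inverse of \<open>V_i\<close>, and \<open>E_i\<close> inverts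
        \<open>D_i\<close>.\<close>
      define W where "W i l = E i * (mat_adjoint (V i) * (F l * R i))" for i l
      have Wc: "W i l \<in> carrier_mat (k i) p" if "i < n" "l < r" for i l
        using that F[OF that(2)] by (intro carrier_matI) (simp_all add: W_def dims dims')
      have hW: "hcat (k i) p r (W i) = E i * (mat_adjoint (V i) * H i)" if "i < n" for i
      proof -
        have "mat_adjoint (V i) * H i = hcat (k i) p r (\<lambda>l. mat_adjoint (V i) * (F l * R i))"
          unfolding H_def using that assms(7) F by (intro mult_hcat[of _ _ p]) (auto intro: mult_carrier_mat[OF _ Rc])
        also have "E i * \<dots> = hcat (k i) p r (W i)"
          unfolding W_def using that assms(7) F E
          by (intro mult_hcat[of _ _ "k i"]) (auto intro!: carrier_matI simp: dims dims')
        finally show ?thesis by simp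
      qed
      have "H i = V i * D i * hcat (k i) p r (W i)" if "i < n" for i
      proof -
        \<comment> \<open>\<open>V_i V_i^*\<close> projects onto the range of \<open>V_i\<close>,
          which contains that of \<open>S_i\<close>; equality of the Gram matrices transfers this to
          \<open>H_i\<close>.\<close>
        have "V i * mat_adjoint (V i) * S i = S i"
          using that by (simp add: S assoc cancel)
        moreover have "V i * mat_adjoint (V i) \<in> carrier_mat p p"
          using that by (intro carrier_matI) (simp_all add: dims)
        moreover have "H i \<in> carrier_mat p (r * p)" by (simp add: H_def)
        ultimately have "V i * mat_adjoint (V i) * H i = H i"
          using fixes_if_gram_eq[OF _ Sc _ gram[OF that that]] by metis
        then show ?thesis using that by (simp add: hW assoc Hdim cancel)
      qed
      moreover have "hcat (k i) p r (W i) * mat_adjoint (hcat (k j) p r (W j)) = transpose_mat (U i) * mat_conj (U j)"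
        if "i < n" "j < n" for i j
      proof -
        \<comment> \<open>Replacing \<open>H_i H_j^*\<close> by the factored
          \<open>S_i S_j^*\<close> lets everything but the \<open>U\<close> factors cancel. The
          final \<open>D_j E_j\<close> has no factor behind it, hence the use of \<open>E(3)\<close>
          itself.\<close>
        have "hcat (k i) p r (W i) * mat_adjoint (hcat (k j) p r (W j)) =
            E i * (mat_adjoint (V i) * ((H i * mat_adjoint (H j)) * (V j * E j)))"
          using that by (simp add: hW assoc Hdim E(4))
        also have "\<dots> = transpose_mat (U i) * mat_conj (U j)"
          unfolding gram[OF that] S[OF that(1)] Sadj[OF that(2)] using that by (simp add: assoc cancel E(3))
        finally show ?thesis .
      qed
      ultimately show condition_c
        unfolding condition_c_def using F one Wc unfolding H_def R_def by blast
    qed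
  qed
  ultimately show ?thesis by blast
qed

end
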